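(* Let $q\in\{2,3\}$, let $\mathcal{M}$ be a hereditary class of $GF(q)$-matroids, and let $\mathcal{F}$ be the set of its forbidden flats. For a matroid $F\in\mathcal{F}$, let $r=r(F)$ and $k=k(F)$ be the rank and the number of non-elements of $F$, respectively, and let $s$ denote the maximum rank of a matroid in $\mathcal{F}$. If $M$ is a forbidden flat for the add class $\mathcal{M}^{+}$, then the rank of $M$ is at most $\max_{F\in\mathcal{F}}\{2s,\ r(F)+k(F)(s-1)\}$.
   Context: All matroids are simple. A $GF(q)$-matroid is a matroid representable over the field with $q$ elements. A class $\mathcal{M}$ of $GF(q)$-matroids is hereditary if it is closed under taking flats (restrictions to flats). A forbidden flat for $\mathcal{M}$ is a $GF(q)$-matroid not in $\mathcal{M}$ every proper flat of which is in $\mathcal{M}$. For $q\in\{2,3\}$, a 2-coloring of the projective geometry $PG(r-1,q)$ is a partition $(G,R)$ of its elements such that $PG(r-1,q)|G$ has rank $r$; if $PG(r-1,q)|G\cong M$, the elements of $R$ are the non-elements of $M$ (their number is independent of the coloring, namely the number of points of $PG(r(M)-1,q)$ minus $|E(M)|$). The add class $\mathcal{M}^{+}$ is the class of $GF(q)$-matroids $M$ such that $M\in\mathcal{M}$, or there is a single-element $GF(q)$-extension $N$ of $M$ (so $N\backslash e\cong M$) with $N\in\mathcal{M}$; equivalently, for a 2-coloring $(G,R)$ with $PG(r-1,q)|G\cong M$, there is $e\in R$ with $PG(r-1,q)|(G\cup e)\in\mathcal{M}$. *)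

theory Defs
  imports "HOL-Library.Function_Algebras" "HOL-Library.Infinite_Typeclass" "HOL-Library.Cardinality"
begin

section \<open>Finite matroids\<close>

datatype 'e matroid = Matroid (ground: "'e set") (indeps: "'e set set")

definition is_matroid :: "'e matroid \<Rightarrow> bool" where
  "is_matroid M \<longleftrightarrow>
     finite (ground M) \<and>
     indeps M \<subseteq> Pow (ground M) \<and>
     {} \<in> indeps M \<and>
     (\<forall>I\<in>indeps M. \<forall>J\<subseteq>I. J \<in> indeps M) \<and>
     (\<forall>I\<in>indeps M. \<forall>J\<in>indeps M. card I < card J \<longrightarrow> (\<exists>e\<in>J - I. insert e I \<in> indeps M))"

definition rank_of :: "'e matroid \<Rightarrow> 'e set \<Rightarrow> nat" where
  "rank_of M X = Max (card ` {I \<in> indeps M. I \<subseteq> X})"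

definition mrank :: "'e matroid \<Rightarrow> nat" where
  "mrank M = rank_of M (ground M)"

definition flat :: "'e matroid \<Rightarrow> 'e set \<Rightarrow> bool" where
  "flat M X \<longleftrightarrow> X \<subseteq> ground M \<and> (\<forall>e\<in>ground M - X. rank_of M X < rank_of M (insert e X))"

definition restrict_to :: "'e matroid \<Rightarrow> 'e set \<Rightarrow> 'e matroid" where
  "restrict_to M X = Matroid (ground M \<inter> X) {I \<in> indeps M. I \<subseteq> X}"

definition delete :: "'e matroid \<Rightarrow> 'e \<Rightarrow> 'e matroid" where
  "delete M e = restrict_to M (ground M - {e})"

definition simple :: "'e matroid \<Rightarrow> bool" where
  "simple M \<longleftrightarrow> (\<forall>x\<in>ground M. \<forall>y\<in>ground M. {x, y} \<in> indeps M)"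

definition matroid_iso :: "'a matroid \<Rightarrow> 'b matroid \<Rightarrow> bool" where
  "matroid_iso M N \<longleftrightarrow>
     (\<exists>f. bij_betw f (ground M) (ground N) \<and>
          (\<forall>X\<subseteq>ground M. X \<in> indeps M \<longleftrightarrow> f ` X \<in> indeps N))"

section \<open>Vectors and projective geometries over a field\<close>

definition fscale :: "'f::field \<Rightarrow> (nat \<Rightarrow> 'f) \<Rightarrow> nat \<Rightarrow> 'f" where
  "fscale c v = (\<lambda>i. c * v i)"

global_interpretation fvs: vector_space "fscale :: 'f::field \<Rightarrow> (nat \<Rightarrow> 'f) \<Rightarrow> nat \<Rightarrow> 'f"
  by unfold_locales (auto simp: fscale_def fun_eq_iff algebra_simps)

text \<open>The space \<open>'f\<close> to the power \<open>n\<close>, as the vectors supported on the first \<open>n\<close> coordinates.\<close>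

definition coord_space :: "nat \<Rightarrow> (nat \<Rightarrow> 'f::field) set" where
  "coord_space n = {v. \<forall>i\<ge>n. v i = 0}"

text \<open>The points of the projective geometry of rank \<open>r\<close>, i.e. of \<open>PG(r-1,q)\<close> with \<open>q = CARD('f)\<close>:
  the one-dimensional subspaces of the \<open>r\<close>-dimensional coordinate space.\<close>

definition pg_points :: "nat \<Rightarrow> (nat \<Rightarrow> 'f::field) set set" where
  "pg_points r = {fvs.span {v} | v. v \<in> coord_space r \<and> v \<noteq> 0}"

section \<open>Classes of matroids over a finite field\<close>

definition representable :: "'f::field itself \<Rightarrow> 'e matroid \<Rightarrow> bool" where
  "representable _ M \<longleftrightarrow>
     (\<exists>n. \<exists>\<phi> :: 'e \<Rightarrow> nat \<Rightarrow> 'f. \<phi> ` ground M \<subseteq> coord_space n \<and>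
        (\<forall>X\<subseteq>ground M. X \<in> indeps M \<longleftrightarrow> inj_on \<phi> X \<and> fvs.independent (\<phi> ` X)))"

definition gf_matroid :: "'f::{field,finite} itself \<Rightarrow> 'e matroid \<Rightarrow> bool" where
  "gf_matroid F M \<longleftrightarrow> is_matroid M \<and> simple M \<and> representable F M"

text \<open>Over an infinite type \<open>'e\<close> of labels, every finite matroid has an isomorphic copy, so an
  isomorphism-closed set of matroids on \<open>'e\<close> is the same thing as a class of matroids.\<close>

definition gf_class :: "'f::{field,finite} itself \<Rightarrow> 'e matroid set \<Rightarrow> bool" where
  "gf_class F \<M> \<longleftrightarrow>
     (\<forall>M\<in>\<M>. gf_matroid F M) \<and>
     (\<forall>M\<in>\<M>. \<forall>N. is_matroid N \<and> matroid_iso M N \<longrightarrow> N \<in> \<M>)"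

definition hereditary :: "'e matroid set \<Rightarrow> bool" where
  "hereditary \<M> \<longleftrightarrow> (\<forall>M\<in>\<M>. \<forall>X. flat M X \<longrightarrow> restrict_to M X \<in> \<M>)"

definition forbidden_flats :: "'f::{field,finite} itself \<Rightarrow> 'e matroid set \<Rightarrow> 'e matroid set" where
  "forbidden_flats F \<M> =
     {M. gf_matroid F M \<and> M \<notin> \<M> \<and> (\<forall>X. flat M X \<and> X \<noteq> ground M \<longrightarrow> restrict_to M X \<in> \<M>)}"

text \<open>The extension \<open>N\<close> is not required to have the rank of \<open>M\<close>. For hereditary \<open>\<M>\<close> this makes no
  difference: if \<open>e\<close> is a coloop of \<open>N\<close>, then \<open>N\<close> minus \<open>e\<close> is the restriction of \<open>N\<close> to a flat.\<close>

definition add_class :: "'f::{field,finite} itself \<Rightarrow> 'e matroid set \<Rightarrow> 'e matroid set" where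
  "add_class F \<M> =
     {M. gf_matroid F M \<and>
         (M \<in> \<M> \<or> (\<exists>N e. gf_matroid F N \<and> e \<in> ground N \<and> matroid_iso (delete N e) M \<and> N \<in> \<M>))}"

text \<open>The subtraction never truncates on a simple representable matroid, whose elements embed
  into the points of the projective geometry of the same rank.\<close>

definition num_nonelements :: "'f::{field,finite} itself \<Rightarrow> 'e matroid \<Rightarrow> nat" where
  "num_nonelements _ M = card (pg_points (mrank M) :: (nat \<Rightarrow> 'f) set set) - card (ground M)"

end

theory Submission
  imports Defs
begin

text \<open>
  Let \<open>X\<close> be a forbidden flat of \<open>\<M>\<close> inside the forbidden flat \<open>M\<close> of the add class. Adding to \<open>M\<close> one of the
  at most \<open>k\<close> missing points \<open>P\<close> in the span of \<open>X\<close> never gives a member of \<open>\<M>\<close>, so the extension by \<open>P\<close>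
  has a forbidden flat \<open>Y P\<close>; adding a point outside the span of \<open>X\<close> keeps \<open>X\<close> a flat. Hence the closure of
  \<open>X\<close> together with all \<open>Y P\<close> is already outside the add class and must be all of \<open>M\<close>. If the spans of
  \<open>X\<close> and \<open>Y P\<close> meet nontrivially, then \<open>Y P\<close> contributes at most \<open>s - 1\<close> to the rank; if for some \<open>P\<close> they
  do not, then \<open>X\<close> and this \<open>Y P\<close> alone suffice, which gives \<open>2 * s\<close>.

  The argument treats an abstract one-element extension as the addition of a point to a fixed representation, which
  is legitimate because representations over fields with two or three elements are projectively unique.
  Uniqueness is proved by adding one vector at a time. Two vectors \<open>u\<close>, \<open>v\<close> that lie in the same
  spans of subsets agree up to sign in each coordinate, so \<open>u + v\<close> and \<open>u - v\<close> have disjoint supports with respect to every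
  basis; then they lie in different components of the configuration, and changing the sign on one of the two sides
  takes \<open>u\<close> to \<open>v\<close>.
\<close>

global_interpretation fvp: vector_space_pair
  "fscale :: 'f::field \<Rightarrow> (nat \<Rightarrow> 'f) \<Rightarrow> nat \<Rightarrow> 'f" "fscale :: 'f \<Rightarrow> (nat \<Rightarrow> 'f) \<Rightarrow> nat \<Rightarrow> 'f"
  by unfold_locales

section \<open>Unique representability over fields with at most three elements\<close>

definition basis_of :: "(nat \<Rightarrow> 'f::field) set \<Rightarrow> (nat \<Rightarrow> 'f) set \<Rightarrow> bool" where
  "basis_of S B \<longleftrightarrow> B \<subseteq> S \<and> fvs.independent B \<and> S \<subseteq> fvs.span B"

text \<open>For independent \<open>B\<close> and \<open>v\<close> in its span, these are the basis
  vectors with a nonzero coordinate in \<open>v\<close>. Phrased by spans, the notion depends only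
  on which subsets of \<open>B\<close> span \<open>v\<close>.\<close>

definition supp :: "(nat \<Rightarrow> 'f::field) set \<Rightarrow> (nat \<Rightarrow> 'f) \<Rightarrow> (nat \<Rightarrow> 'f) set" where
  "supp B v = {b \<in> B. v \<notin> fvs.span (B - {b})}"

text \<open>If \<open>B\<close> is a basis and \<open>x\<close> lies in \<open>S - B\<close>, then
  \<open>supp B x\<close> together with \<open>x\<close> is a fundamental circuit. So the components
  of this graph on \<open>B\<close> are the traces of the connected components of the configuration
  \<open>S\<close>.\<close>

definition linked :: "(nat \<Rightarrow> 'f::field) set \<Rightarrow> (nat \<Rightarrow> 'f) set \<Rightarrow> ((nat \<Rightarrow> 'f) \<times> (nat \<Rightarrow> 'f)) set" where
  "linked S B = {(c, d). \<exists>x\<in>S. c \<in> supp B x \<and> d \<in> supp B x}"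

lemma basis_of_span: "basis_of S B \<Longrightarrow> fvs.span B = fvs.span S"
  unfolding basis_of_def
  by (metis fvs.span_mono fvs.span_span subset_antisym)

lemma basis_of_exchange:
  assumes B: "basis_of S B" and x: "x \<in> S" and c: "c \<in> supp B x"
  shows "basis_of S (insert x (B - {c}))"
proof -
  have cB: "c \<in> B" and xn: "x \<notin> fvs.span (B - {c})"
    using c by (auto simp: supp_def)
  have BS: "B \<subseteq> S" and indB: "fvs.independent B" and SB: "S \<subseteq> fvs.span B"
    using B by (auto simp: basis_of_def)
  have "fvs.independent (B - {c})"
    using indB fvs.independent_mono by blast
  then have ind: "fvs.independent (insert x (B - {c}))"
    using xn fvs.independent_insertI by blast
  have "c \<in> fvs.span (insert x (B - {c}))"
    using fvs.in_span_delete[OF _ xn] SB x by blast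
  then have "B \<subseteq> fvs.span (insert x (B - {c}))"
    using fvs.span_base[of _ "insert x (B - {c})"] by blast
  then have "fvs.span B \<subseteq> fvs.span (insert x (B - {c}))"
    by (metis fvs.span_mono fvs.span_span)
  then show ?thesis
    using ind SB BS x unfolding basis_of_def by blast
qed

text \<open>An expansion that does not use \<open>c\<close> is untouched when \<open>c\<close> is
  replaced by \<open>x\<close>.\<close>

lemma supp_exchange_keep:
  assumes c: "c \<in> supp B x" and v: "v \<in> fvs.span (B - {c})" and d: "d \<in> supp B v"
  shows "d \<in> supp (insert x (B - {c})) v"
proof -
  have cB: "c \<in> B" and xn: "x \<notin> fvs.span (B - {c})" and dB: "d \<in> B"
    and vn: "v \<notin> fvs.span (B - {d})"
    using c d by (auto simp: supp_def)
  have dc: "d \<noteq> c" using v vn by auto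
  have vn': "v \<notin> fvs.span (B - {c} - {d})"
    using vn fvs.span_mono[of "B - {c} - {d}" "B - {d}"] by blast
  have "v \<notin> fvs.span (insert x (B - {c} - {d}))"
  proof
    assume "v \<in> fvs.span (insert x (B - {c} - {d}))"
    then have "x \<in> fvs.span (insert v (B - {c} - {d}))"
      using vn' fvs.in_span_insert by blast
    moreover have "insert v (B - {c} - {d}) \<subseteq> fvs.span (B - {c})"
      using v fvs.span_base[of _ "B - {c}"] by blast
    ultimately show False
      using xn fvs.span_mono fvs.span_span by blast
  qed
  moreover have "insert x (B - {c}) - {d} \<subseteq> insert x (B - {c} - {d})" by auto
  ultimately have "v \<notin> fvs.span (insert x (B - {c}) - {d})"
    using fvs.span_mono by blast
  then show ?thesis using dB dc by (auto simp: supp_def)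
qed

text \<open>Solving for \<open>c\<close> in terms of \<open>x\<close> and substituting brings the
  coordinate of \<open>x\<close> at \<open>d\<close> into the expansion of \<open>a\<close>, which
  had none there, so nothing can cancel it.\<close>

lemma supp_exchange_shift:
  assumes c: "c \<in> supp B x" and d: "d \<in> supp B x"
    and ca: "c \<in> supp B a" and da: "d \<notin> supp B a"
  shows "d \<in> supp (insert x (B - {c})) a"
proof -
  have cB: "c \<in> B" and dB: "d \<in> B" and xd: "x \<notin> fvs.span (B - {d})"
    and ac: "a \<notin> fvs.span (B - {c})" and ad: "a \<in> fvs.span (B - {d})"
    using assms by (auto simp: supp_def)
  have an: "a \<notin> fvs.span (B - {c} - {d})"
    using ac fvs.span_mono[of "B - {c} - {d}" "B - {c}"] by blast
  have "a \<notin> fvs.span (insert x (B - {c} - {d}))"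
  proof
    assume "a \<in> fvs.span (insert x (B - {c} - {d}))"
    then have "x \<in> fvs.span (insert a (B - {c} - {d}))"
      using an fvs.in_span_insert by blast
    moreover have "insert a (B - {c} - {d}) \<subseteq> fvs.span (B - {d})"
      using ad fvs.span_base[of _ "B - {d}"] by blast
    ultimately show False
      using xd fvs.span_mono fvs.span_span by blast
  qed
  moreover have "insert x (B - {c}) - {d} \<subseteq> insert x (B - {c} - {d})" by auto
  ultimately have "a \<notin> fvs.span (insert x (B - {c}) - {d})"
    using fvs.span_mono by blast
  moreover have "d \<noteq> c" using ca da by auto
  ultimately show ?thesis using dB by (auto simp: supp_def)
qed

text \<open>Exchanging along the first edge of a shortest path shortens it.\<close>

lemma linked_supports_meet:
  assumes "basis_of S B" "c \<in> supp B a" "d \<in> supp B b" "(c, d) \<in> linked S B ^^ n"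
  shows "\<exists>B'. basis_of S B' \<and> supp B' a \<inter> supp B' b \<noteq> {}"
  using assms
proof (induction n arbitrary: B c d rule: less_induct)
  case (less n)
  show ?case
  proof (cases "\<exists>m<n. \<exists>c'\<in>supp B a. \<exists>d'\<in>supp B b. (c', d') \<in> linked S B ^^ m")
    case True
    then show ?thesis using less.IH less.prems(1) by blast
  next
    case False
    then have minimal: "\<And>m c' d'. m < n \<Longrightarrow> c' \<in> supp B a \<Longrightarrow> d' \<in> supp B b \<Longrightarrow> (c', d') \<notin> linked S B ^^ m"
      by blast
    show ?thesis
    proof (cases "n = 0")
      case True
      then show ?thesis using less.prems by auto
    next
      case n: False
      obtain f where f0: "f 0 = c" and fn: "f n = d"
        and fs: "\<And>i. i < n \<Longrightarrow> (f i, f (Suc i)) \<in> linked S B"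
        using less.prems(4) unfolding relpow_fun_conv by blast
      have path: "(f i, d) \<in> linked S B ^^ (n - i)" if "i \<le> n" for i
        unfolding relpow_fun_conv
        by (rule exI[of _ "\<lambda>j. f (i + j)"]) (use that fn fs in auto)
      have "\<forall>i. \<exists>x. i < n \<longrightarrow> x \<in> S \<and> f i \<in> supp B x \<and> f (Suc i) \<in> supp B x"
        using fs unfolding linked_def by blast
      then obtain x where x: "\<And>i. i < n \<Longrightarrow> x i \<in> S \<and> f i \<in> supp B (x i) \<and> f (Suc i) \<in> supp B (x i)"
        by metis
      have cB: "c \<in> B" using less.prems(2) by (auto simp: supp_def)
      \<comment> \<open>By minimality only the ends of the path meet the two supports:
        \<open>c\<close> is not in the support of \<open>b\<close>, and the next vertex is not in
        that of \<open>a\<close>.\<close>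
      have c_b: "b \<in> fvs.span (B - {c})"
        using minimal[of 0 c c] n less.prems(2) cB by (auto simp: supp_def)
      have f1: "f (Suc 0) \<notin> supp B a"
        using minimal[of "n - Suc 0" "f (Suc 0)" d] path[of "Suc 0"] n less.prems(3) by auto
      \<comment> \<open>A later edge using \<open>c\<close> would give a chord that shortens the
        path, so all later edges survive the exchange by \<open>supp_exchange_keep\<close>.\<close>
      have c_x: "x i \<in> fvs.span (B - {c})" if i: "0 < i" "i < n" for i
      proof (rule ccontr)
        assume "x i \<notin> fvs.span (B - {c})"
        then have "c \<in> supp B (x i)" using cB by (auto simp: supp_def)
        then have "(c, f (Suc i)) \<in> linked S B"
          using x[of i] i unfolding linked_def by blast
        moreover have "(f (Suc i), d) \<in> linked S B ^^ (n - Suc i)"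
          using path[of "Suc i"] i by simp
        ultimately have "(c, d) \<in> linked S B ^^ (Suc (n - Suc i))"
          by (rule relpow_Suc_I2)
        moreover have "Suc (n - Suc i) < n" using i by simp
        ultimately show False using minimal less.prems(2,3) by blast
      qed
      define B' where "B' = insert (x 0) (B - {c})"
      have x0: "x 0 \<in> S" "c \<in> supp B (x 0)" "f (Suc 0) \<in> supp B (x 0)"
        using x[of 0] n f0 by auto
      have "basis_of S B'"
        unfolding B'_def using basis_of_exchange less.prems(1) x0 by blast
      moreover have "f (Suc 0) \<in> supp B' a"
        unfolding B'_def using supp_exchange_shift[OF x0(2,3) less.prems(2) f1] .
      moreover have "d \<in> supp B' b"
        unfolding B'_def using supp_exchange_keep[OF x0(2) c_b less.prems(3)] .
      moreover have "(f (Suc 0), d) \<in> linked S B' ^^ (n - 1)"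
        unfolding relpow_fun_conv
      proof (rule exI[of _ "\<lambda>j. f (Suc j)"], intro conjI allI impI)
        show "f (Suc (n - 1)) = d" using n fn by simp
        fix i assume i: "i < n - 1"
        have "f (Suc i) \<in> supp B' (x (Suc i))" "f (Suc (Suc i)) \<in> supp B' (x (Suc i))"
          unfolding B'_def
          using supp_exchange_keep[OF x0(2) c_x[of "Suc i"]] x[of "Suc i"] i by auto
        then show "(f (Suc i), f (Suc (Suc i))) \<in> linked S B'"
          using x[of "Suc i"] i unfolding linked_def by auto
      qed simp
      ultimately show ?thesis
        using less.IH[of "n - 1" B' "f (Suc 0)" d] n by auto
    qed
  qed
qed

text \<open>Coordinates over an independent set are unique, so each hypothesis says that one
  coordinate of \<open>w\<close> vanishes, and these conditions can be imposed
  simultaneously.\<close>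

lemma span_Diff_if_spans_delete:
  assumes B: "fvs.independent B" and w: "w \<in> fvs.span B"
    and R: "\<And>c. c \<in> R \<Longrightarrow> w \<in> fvs.span (B - {c})"
  shows "w \<in> fvs.span (B - R)"
proof -
  have "fvs.representation B w c = 0" if "c \<in> R" for c
  proof -
    have "fvs.representation B w c = fvs.representation (B - {c}) w c"
      using fvs.representation_extend[OF B R[OF that]] by auto
    also have "\<dots> = 0" using fvs.representation_ne_zero by blast
    finally show ?thesis .
  qed
  then have *: "c \<in> B - R" if "fvs.representation B w c \<noteq> 0" for c
    using fvs.representation_ne_zero[OF that] that by blast
  have "(\<Sum>b | fvs.representation B w b \<noteq> 0. fscale (fvs.representation B w b) b) \<in> fvs.span (B - R)"
    by (intro fvs.span_sum fvs.span_scale fvs.span_base) (use * in auto)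
  then show ?thesis
    using fvs.sum_nonzero_representation_eq[OF B w] by simp
qed

text \<open>The restriction on the field size enters here. If the claim failed, either
  \<open>0\<close>, \<open>c\<close>, \<open>d\<close> would be the whole field although
  \<open>c + d\<close> is none of them, or \<open>0\<close>, \<open>c\<close>, \<open>d\<close>,
  \<open>- d\<close> would be four scalars.\<close>

lemma card_le_3_sign:
  fixes c d :: "'f::{field,finite}"
  assumes "CARD('f) \<in> {2, 3}" "c \<noteq> 0" "d \<noteq> 0"
  shows "c = d \<or> c = - d"
proof (rule ccontr)
  assume cd: "\<not> (c = d \<or> c = - d)"
  show False
  proof (cases "- d = d")
    case True
    then have "card {0, c, d} = 3" using cd assms by auto
    then have "card (UNIV :: 'f set) = 3"
      using card_mono[of UNIV "{0, c, d}"] assms(1) by auto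
    then have U: "UNIV = {0, c, d}"
      using \<open>card {0, c, d} = 3\<close> by (metis card_subset_eq finite subset_UNIV)
    have "c + d \<in> {0, c, d}" using U by blast
    then show False using assms cd by (auto simp: add_eq_0_iff2)
  next
    case False
    then have "card {0, c, d, - d} = 4" using cd assms by auto
    then show False using card_mono[of UNIV "{0, c, d, - d}"] assms(1) by auto
  qed
qed

text \<open>The coordinates of \<open>u\<close> and \<open>v\<close> at \<open>c\<close> are both
  zero or agree up to sign, so the sum or the difference cancels at \<open>c\<close>.\<close>

lemma same_spans_sign:
  fixes u v :: "nat \<Rightarrow> 'f::{field,finite}"
  assumes q: "CARD('f) \<in> {2, 3}" and u: "u \<in> fvs.span B" and v: "v \<in> fvs.span B" and c: "c \<in> B"
    and uv: "u \<in> fvs.span (B - {c}) \<longleftrightarrow> v \<in> fvs.span (B - {c})"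
  shows "u + v \<in> fvs.span (B - {c}) \<or> u - v \<in> fvs.span (B - {c})"
proof (cases "u \<in> fvs.span (B - {c})")
  case True
  then show ?thesis using uv fvs.span_add by blast
next
  case False
  obtain k l where k: "u - fscale k c \<in> fvs.span (B - {c})" and l: "v - fscale l c \<in> fvs.span (B - {c})"
    using fvs.span_breakdown[OF c] u v by blast
  have "k \<noteq> 0" "l \<noteq> 0" using False uv k l by auto
  then consider "k = l" | "k = - l" using card_le_3_sign[OF q] by blast
  then show ?thesis
  proof cases
    case 1
    then show ?thesis using fvs.span_diff[OF k l] by simp
  next
    case 2
    then show ?thesis using fvs.span_add[OF k l] by simp
  qed
qed

text \<open>With \<open>R\<close> the set of basis vectors that can be reached from the support of \<open>u + v\<close>,
  the map that is the identity on \<open>R\<close> and \<open>-1\<close> on the other basis vectors takes \<open>u\<close> to \<open>v\<close>.\<close>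

lemma same_spans_projective:
  fixes S :: "(nat \<Rightarrow> 'f::{field,finite}) set"
  assumes q: "CARD('f) \<in> {2, 3}" and u: "u \<in> fvs.span S" and v: "v \<in> fvs.span S"
    and uv: "\<And>X. X \<subseteq> S \<Longrightarrow> u \<in> fvs.span X \<longleftrightarrow> v \<in> fvs.span X"
  shows "\<exists>T. Vector_Spaces.linear fscale fscale T \<and> inj_on T (fvs.span S) \<and> T u = v \<and>
           (\<forall>x\<in>S. T x = x \<or> T x = - x)"
proof -
  obtain B where B: "basis_of S B"
    by (metis basis_of_def fvs.maximal_independent_subset)
  have BS: "B \<subseteq> S" and indB: "fvs.independent B" and spB: "fvs.span B = fvs.span S"
    using B basis_of_span by (auto simp: basis_of_def)
  define a b where "a = u + v" and "b = u - v"
  have aS: "a \<in> fvs.span S" and bS: "b \<in> fvs.span S"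
    using u v fvs.span_add fvs.span_diff by (auto simp: a_def b_def)
  \<comment> \<open>At each basis vector \<open>a\<close> or \<open>b\<close> has coordinate zero.
    This holds for all bases of \<open>S\<close> at once, as is needed to contradict
    \<open>linked_supports_meet\<close>.\<close>
  have disjoint: "supp B' a \<inter> supp B' b = {}" if "basis_of S B'" for B'
  proof -
    have "c \<notin> supp B' b" if "c \<in> supp B' a" for c
      using same_spans_sign[OF q, of u B' v c] that u v uv[of "B' - {c}"] \<open>basis_of S B'\<close>
        basis_of_span[OF \<open>basis_of S B'\<close>]
      by (auto simp: supp_def a_def b_def basis_of_def)
    then show ?thesis by blast
  qed
  define R where "R = (linked S B)\<^sup>* `` supp B a"
  have RB: "R \<subseteq> B"
  proof
    fix d assume "d \<in> R"
    then obtain c where c: "c \<in> supp B a" and "(c, d) \<in> (linked S B)\<^sup>*" by (auto simp: R_def)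
    from this(2) show "d \<in> B"
      by (induction rule: rtrancl_induct) (use c in \<open>auto simp: supp_def linked_def\<close>)
  qed
  \<comment> \<open>A path from the support of \<open>a\<close> to that of \<open>b\<close> would
    produce a basis for which these supports meet.\<close>
  have Rb: "R \<inter> supp B b = {}"
  proof -
    have False if "c \<in> supp B a" "d \<in> supp B b" "(c, d) \<in> (linked S B)\<^sup>*" for c d
      using linked_supports_meet[OF B that(1,2)] rtrancl_imp_relpow[OF that(3)] disjoint by blast
    then show ?thesis unfolding R_def by blast
  qed
  have a_R: "a \<in> fvs.span R"
  proof -
    have "a \<in> fvs.span (B - (B - R))"
      by (rule span_Diff_if_spans_delete[OF indB])
        (use aS spB in \<open>auto simp: R_def supp_def\<close>)
    then show ?thesis using RB by (simp add: double_diff)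
  qed
  have b_R: "b \<in> fvs.span (B - R)"
    by (rule span_Diff_if_spans_delete[OF indB])
      (use bS spB Rb RB in \<open>auto simp: supp_def\<close>)
  obtain T where T: "Vector_Spaces.linear fscale fscale T"
    and Tb: "\<And>x. x \<in> B \<Longrightarrow> T x = (if x \<in> R then x else - x)"
    using fvp.linear_independent_extend[OF indB, of "\<lambda>x. if x \<in> R then x else - x"] by blast
  interpret T: Vector_Spaces.linear fscale fscale T by (rule T)
  have T_R: "T x = x" if "x \<in> fvs.span R" for x
    by (rule fvp.linear_eq_on[OF T fvs.linear_ident that]) (use Tb RB in auto)
  have T_C: "T x = - x" if "x \<in> fvs.span (B - R)" for x
    by (rule fvp.linear_eq_on[OF T fvs.linear_uminus that]) (use Tb in auto)
  have TT: "T (T x) = x" if "x \<in> fvs.span B" for x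
  proof -
    have "Vector_Spaces.linear fscale fscale (T \<circ> T)"
      using Vector_Spaces.linear_compose[OF T T] .
    then have "(T \<circ> T) x = (\<lambda>x. x) x"
      by (rule fvp.linear_eq_on[OF _ fvs.linear_ident that]) (use Tb in \<open>auto simp: T.neg\<close>)
    then show ?thesis by simp
  qed
  have inj: "inj_on T (fvs.span S)"
    by (rule inj_on_inverseI[of _ T]) (use TT spB in auto)
  \<comment> \<open>\<open>R\<close> is a union of components, so the support of an element of
    \<open>S\<close> lies inside \<open>R\<close> or misses it.\<close>
  have S_cases: "x \<in> fvs.span R \<or> x \<in> fvs.span (B - R)" if x: "x \<in> S" for x
  proof (cases "supp B x \<inter> R = {}")
    case True
    have "x \<in> fvs.span (B - R)"
      by (rule span_Diff_if_spans_delete[OF indB])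
        (use True RB x spB fvs.span_base[OF x] in \<open>auto simp: supp_def\<close>)
    then show ?thesis ..
  next
    case False
    then obtain c where "c \<in> R" "c \<in> supp B x" by blast
    then have "supp B x \<subseteq> R"
      using x unfolding R_def linked_def by (auto intro: rtrancl_into_rtrancl)
    then have *: "x \<in> fvs.span (B - {c})" if "c \<in> B - R" for c
      using that by (auto simp: supp_def)
    have "x \<in> fvs.span (B - (B - R))"
      by (rule span_Diff_if_spans_delete[OF indB _ *]) (simp_all add: spB fvs.span_base x)
    then show ?thesis using RB by (simp add: double_diff)
  qed
  \<comment> \<open>\<open>T\<close> fixes \<open>u + v\<close> and negates \<open>u - v\<close>.
    Adding both equations gives twice \<open>T u\<close> equal to twice \<open>v\<close>, which
    settles every characteristic except two.\<close>
  have "T u + T v = u + v"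
    using T_R[OF a_R] unfolding a_def T.add .
  moreover have "T u - T v = - (u - v)"
    using T_C[OF b_R] unfolding b_def T.diff .
  ultimately have "(T u + T v) + (T u - T v) = (u + v) + - (u - v)"
    by (simp only:)
  then have double: "T u + T u = v + v"
    by simp
  have two: "2 * T u i = 2 * v i" for i
    using fun_cong[OF double, of i] unfolding plus_fun_apply mult_2 .
  have "T u = v"
  proof (cases "(2::'f) = 0")
    case False
    then show ?thesis using two by auto
  next
    case True
    \<comment> \<open>In characteristic two \<open>a\<close> and \<open>b\<close> coincide, so their
      disjoint supports are empty. Then \<open>R\<close> is empty, \<open>a\<close> is zero and
      \<open>u = v\<close>, while \<open>T\<close> acts on the span as negation, which is the
      identity.\<close>
    have neg: "- w = w" for w :: "nat \<Rightarrow> 'f"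
    proof
      fix i
      have "w i + w i = 0" unfolding mult_2[symmetric] True by (rule mult_zero_left)
      then show "(- w) i = w i" unfolding uminus_apply by (rule minus_unique)
    qed
    have "u + v = u + - v" unfolding neg ..
    also have "\<dots> = u - v" by (rule add_uminus_conv_diff)
    finally have "a = b" unfolding a_def b_def .
    then have "supp B a = {}" using disjoint[OF B] by simp
    then have R: "R = {}" by (simp add: R_def)
    have "u = v" using b_R a_R \<open>a = b\<close> R by (simp add: b_def)
    moreover have "T u = - u" by (rule T_C) (use R u spB in simp)
    ultimately show ?thesis unfolding neg by simp
  qed
  then show ?thesis
    using T inj S_cases T_R T_C by blast
qed

section \<open>Matroids of vector configurations\<close>

text \<open>Matroids are handled as literal values of this form, so that flats and extensions are
  compared on a common ground set without isomorphisms. \<open>inj_on\<close> makes elements sharing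
  a vector dependent.\<close>

definition vmat :: "('e \<Rightarrow> nat \<Rightarrow> 'f::field) \<Rightarrow> 'e set \<Rightarrow> 'e matroid" where
  "vmat \<phi> E = Matroid E {X. X \<subseteq> E \<and> inj_on \<phi> X \<and> fvs.independent (\<phi> ` X)}"

lemma ground_vmat [simp]: "ground (vmat \<phi> E) = E"
  by (simp add: vmat_def)

lemma indeps_vmat: "X \<in> indeps (vmat \<phi> E) \<longleftrightarrow> X \<subseteq> E \<and> inj_on \<phi> X \<and> fvs.independent (\<phi> ` X)"
  by (simp add: vmat_def)

text \<open>Expresses independence through span membership alone, so that two representations can be
  compared by their spans.\<close>

lemma independent_family_iff:
  "inj_on \<phi> X \<and> fvs.independent (\<phi> ` X) \<longleftrightarrow> (\<forall>x\<in>X. \<phi> x \<notin> fvs.span (\<phi> ` (X - {x})))"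
    (is "?L \<longleftrightarrow> ?R")
proof
  assume L: ?L
  show ?R
  proof
    fix x assume x: "x \<in> X"
    have "\<phi> ` (X - {x}) = \<phi> ` X - {\<phi> x}"
      using inj_on_image_set_diff[of \<phi> X X "{x}"] L x by simp
    moreover have "\<phi> x \<notin> fvs.span (\<phi> ` X - {\<phi> x})"
      using L x unfolding fvs.dependent_def by blast
    ultimately show "\<phi> x \<notin> fvs.span (\<phi> ` (X - {x}))" by simp
  qed
next
  assume R: ?R
  have "inj_on \<phi> X"
  proof (rule inj_onI, rule ccontr)
    fix x y assume "x \<in> X" "y \<in> X" "\<phi> x = \<phi> y" "x \<noteq> y"
    then have "\<phi> x \<in> \<phi> ` (X - {x})" by (intro image_eqI[of _ _ y]) simp_all
    then have "\<phi> x \<in> fvs.span (\<phi> ` (X - {x}))" by (rule fvs.span_base)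
    then show False using R \<open>x \<in> X\<close> by blast
  qed
  moreover have "fvs.independent (\<phi> ` X)"
    unfolding fvs.dependent_def
  proof
    assume "\<exists>a\<in>\<phi> ` X. a \<in> fvs.span (\<phi> ` X - {a})"
    then obtain x where x: "x \<in> X" "\<phi> x \<in> fvs.span (\<phi> ` X - {\<phi> x})" by blast
    have "\<phi> ` X - {\<phi> x} \<subseteq> \<phi> ` (X - {x})" by blast
    from fvs.span_mono[OF this] show False using R x by blast
  qed
  ultimately show ?L ..
qed

lemma independent_family_insert:
  assumes "inj_on \<phi> J" "fvs.independent (\<phi> ` J)" "\<phi> x \<notin> fvs.span (\<phi> ` J)"
  shows "inj_on \<phi> (insert x J) \<and> fvs.independent (\<phi> ` insert x J)"
proof -
  have "\<phi> x \<notin> \<phi> ` J" using assms(3) fvs.span_base by blast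
  then show ?thesis
    using assms by (simp add: fvs.independent_insert inj_on_insert) blast
qed

lemma restrict_to_vmat: "X \<subseteq> E \<Longrightarrow> restrict_to (vmat \<phi> E) X = vmat \<phi> X"
  unfolding restrict_to_def vmat_def by (auto simp: Int_absorb1)

lemma vmat_eqI:
  assumes "\<And>X x. X \<subseteq> E \<Longrightarrow> x \<in> E \<Longrightarrow> \<phi> x \<in> fvs.span (\<phi> ` X) \<longleftrightarrow> \<psi> x \<in> fvs.span (\<psi> ` X)"
  shows "vmat \<phi> E = vmat \<psi> E"
proof -
  have "(\<forall>x\<in>X. \<phi> x \<notin> fvs.span (\<phi> ` (X - {x}))) \<longleftrightarrow> (\<forall>x\<in>X. \<psi> x \<notin> fvs.span (\<psi> ` (X - {x})))"
    if "X \<subseteq> E" for X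
    using that by (intro ball_cong arg_cong[of _ _ Not] assms) auto
  then show ?thesis
    unfolding vmat_def independent_family_iff by (intro arg_cong[of _ _ "Matroid E"] Collect_cong) blast
qed

lemma vmat_cong:
  assumes "\<And>x. x \<in> E \<Longrightarrow> \<phi> x = \<psi> x"
  shows "vmat \<phi> E = vmat \<psi> E"
proof (rule vmat_eqI)
  fix X x assume "X \<subseteq> E" "x \<in> E"
  then have "\<phi> ` X = \<psi> ` X" "\<phi> x = \<psi> x"
    using assms by (auto intro!: image_cong)
  then show "\<phi> x \<in> fvs.span (\<phi> ` X) \<longleftrightarrow> \<psi> x \<in> fvs.span (\<psi> ` X)" by simp
qed

lemma exists_independent_spanning_family:
  fixes \<phi> :: "'e \<Rightarrow> nat \<Rightarrow> 'f::field"
  obtains J where "J \<subseteq> X" "inj_on \<phi> J" "fvs.independent (\<phi> ` J)" "fvs.span (\<phi> ` J) = fvs.span (\<phi> ` X)"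
proof -
  obtain B where B: "B \<subseteq> \<phi> ` X" "fvs.independent B" "\<phi> ` X \<subseteq> fvs.span B"
    by (rule fvs.maximal_independent_subset)
  obtain J where J: "J \<subseteq> X" "inj_on \<phi> J" "B = \<phi> ` J"
    using B(1) by (auto simp: subset_image_inj)
  have "fvs.span B = fvs.span (\<phi> ` X)"
    using B by (metis fvs.span_mono fvs.span_span subset_antisym)
  then show ?thesis using that J B by blast
qed

text \<open>A converse to \<open>vmat_eqI\<close>: with \<open>J\<close> a maximal independent part
  of \<open>X\<close>, an element outside \<open>J\<close> lies in the span exactly when adding it
  to \<open>J\<close> destroys independence, and this can be read off the matroid.\<close>

lemma vmat_eq_span:
  assumes eq: "vmat \<phi> E = vmat \<psi> E" and X: "X \<subseteq> E" and x: "x \<in> E"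
    and sp: "\<phi> x \<in> fvs.span (\<phi> ` X)"
  shows "\<psi> x \<in> fvs.span (\<psi> ` X)"
proof -
  obtain J where J: "J \<subseteq> X" "inj_on \<phi> J" "fvs.independent (\<phi> ` J)" "fvs.span (\<phi> ` J) = fvs.span (\<phi> ` X)"
    by (rule exists_independent_spanning_family)
  then have J\<psi>: "inj_on \<psi> J" "fvs.independent (\<psi> ` J)"
    using X eq indeps_vmat[of J \<phi> E] indeps_vmat[of J \<psi> E] by auto
  have "\<psi> x \<in> fvs.span (\<psi> ` J)"
  proof (cases "x \<in> J")
    case True
    then show ?thesis by (simp add: fvs.span_base)
  next
    case False
    then have "\<phi> x \<in> fvs.span (\<phi> ` (insert x J - {x}))" using sp J by simp
    then have "insert x J \<notin> indeps (vmat \<phi> E)"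
      unfolding indeps_vmat independent_family_iff by blast
    then have "insert x J \<notin> indeps (vmat \<psi> E)" using eq by simp
    then show ?thesis
      using independent_family_insert[OF J\<psi>, of x] x J(1) X unfolding indeps_vmat by blast
  qed
  then show ?thesis using J(1) fvs.span_mono[of "\<psi> ` J" "\<psi> ` X"] by blast
qed

lemma vmat_eq_subset: "vmat \<phi> E = vmat \<psi> E \<Longrightarrow> X \<subseteq> E \<Longrightarrow> vmat \<phi> X = vmat \<psi> X"
  by (metis restrict_to_vmat)

section \<open>Scaling and linear images of a configuration\<close>

lemma span_image_scaled:
  assumes "\<And>x. x \<in> X \<Longrightarrow> \<exists>c. c \<noteq> 0 \<and> \<psi> x = fscale c (\<phi> x)"
  shows "fvs.span (\<psi> ` X) = fvs.span (\<phi> ` X)"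
  unfolding fvs.span_eq
proof (intro conjI image_subsetI)
  fix x assume x: "x \<in> X"
  obtain c where c: "c \<noteq> 0" "\<psi> x = fscale c (\<phi> x)" using assms x by blast
  show "\<psi> x \<in> fvs.span (\<phi> ` X)" unfolding c(2)
    using x by (intro fvs.span_scale fvs.span_base) auto
  have "\<phi> x = fscale (inverse c) (\<psi> x)"
    using c by (simp add: fvs.scale_scale)
  also have "\<dots> \<in> fvs.span (\<psi> ` X)"
    using x by (intro fvs.span_scale fvs.span_base) auto
  finally show "\<phi> x \<in> fvs.span (\<psi> ` X)" .
qed

lemma span_scaled_iff:
  assumes "c \<noteq> 0"
  shows "fscale c v \<in> fvs.span X \<longleftrightarrow> v \<in> fvs.span X"
proof
  assume "fscale c v \<in> fvs.span X"
  then have "fscale (inverse c) (fscale c v) \<in> fvs.span X" by (rule fvs.span_scale)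
  then show "v \<in> fvs.span X" using assms by simp
qed (rule fvs.span_scale)

lemma linear_image_span_iff:
  assumes T: "Vector_Spaces.linear fscale fscale T" and inj: "inj_on T (fvs.span W)"
    and X: "X \<subseteq> fvs.span W" and u: "u \<in> fvs.span W"
  shows "T u \<in> fvs.span (T ` X) \<longleftrightarrow> u \<in> fvs.span X"
proof -
  have "fvs.span X \<subseteq> fvs.span W" using X by (metis fvs.span_mono fvs.span_span)
  then show ?thesis
    unfolding fvp.linear_span_image[OF T] using inj u by (simp add: inj_on_image_mem_iff)
qed

text \<open>A linear map injective on the span preserves and reflects span membership, and rescaling
  single vectors does not change the spans of subfamilies. The converse over small fields is
  \<open>unique_representation\<close>.\<close>

lemma vmat_linear_image:
  assumes T: "Vector_Spaces.linear fscale fscale T" and inj: "inj_on T (fvs.span (\<phi> ` E))"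
    and c: "\<And>x. x \<in> E \<Longrightarrow> \<exists>c. c \<noteq> 0 \<and> \<psi> x = fscale c (T (\<phi> x))"
  shows "vmat \<psi> E = vmat \<phi> E"
proof (rule vmat_eqI)
  fix X x assume X: "X \<subseteq> E" and x: "x \<in> E"
  have "fvs.span (\<psi> ` X) = fvs.span ((\<lambda>x. T (\<phi> x)) ` X)"
    using c X by (intro span_image_scaled) auto
  moreover obtain k where "k \<noteq> 0" "\<psi> x = fscale k (T (\<phi> x))"
    using c[OF x] by blast
  ultimately have "\<psi> x \<in> fvs.span (\<psi> ` X) \<longleftrightarrow> T (\<phi> x) \<in> fvs.span (T ` \<phi> ` X)"
    by (simp add: image_image span_scaled_iff)
  also have "\<dots> \<longleftrightarrow> \<phi> x \<in> fvs.span (\<phi> ` X)"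
    by (rule linear_image_span_iff[OF T inj]) (use X x in \<open>auto intro: fvs.span_base\<close>)
  finally show "\<psi> x \<in> fvs.span (\<psi> ` X) \<longleftrightarrow> \<phi> x \<in> fvs.span (\<phi> ` X)" .
qed

text \<open>A basis fixes a linear map. For each further element
  \<open>same_spans_projective\<close> corrects it by a map that changes the images treated so far
  at most by sign.\<close>

theorem unique_representation:
  fixes \<phi> \<psi> :: "'e \<Rightarrow> nat \<Rightarrow> 'f::{field,finite}"
  assumes q: "CARD('f) \<in> {2, 3}" and E: "finite E" and eq: "vmat \<phi> E = vmat \<psi> E"
  shows "\<exists>T. Vector_Spaces.linear fscale fscale T \<and> inj_on T (fvs.span (\<phi> ` E)) \<and>
           (\<forall>x\<in>E. \<exists>c. c \<noteq> 0 \<and> \<psi> x = fscale c (T (\<phi> x)))"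
proof -
  obtain J where J: "J \<subseteq> E" "inj_on \<phi> J" "fvs.independent (\<phi> ` J)" "fvs.span (\<phi> ` J) = fvs.span (\<phi> ` E)"
    by (rule exists_independent_spanning_family)
  have J\<psi>: "inj_on \<psi> J" "fvs.independent (\<psi> ` J)"
    using J eq indeps_vmat[of J \<phi> E] indeps_vmat[of J \<psi> E] by auto
  have "\<exists>T. Vector_Spaces.linear fscale fscale T \<and> inj_on T (fvs.span (\<phi> ` E)) \<and>
           (\<forall>x\<in>J \<union> A. \<exists>c. c \<noteq> 0 \<and> \<psi> x = fscale c (T (\<phi> x)))"
    if "finite A" "A \<subseteq> E" for A
    using that
  proof (induction A rule: finite_induct)
    case empty
    obtain T where T: "Vector_Spaces.linear fscale fscale T"
      and T': "\<And>x. x \<in> \<phi> ` J \<Longrightarrow> T x = \<psi> (inv_into J \<phi> x)"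
      using fvp.linear_independent_extend[OF J(3), of "\<lambda>x. \<psi> (inv_into J \<phi> x)"] by blast
    have TJ: "T (\<phi> x) = \<psi> x" if "x \<in> J" for x
      using that T' J(2) by simp
    have "inj_on T (\<phi> ` J)"
      using TJ J\<psi>(1) by (auto simp: inj_on_def)
    moreover have "T ` \<phi> ` J = \<psi> ` J"
      unfolding image_image by (rule image_cong[OF refl TJ])
    ultimately have "inj_on T (fvs.span (\<phi> ` E))"
      using fvp.linear_inj_on_span_independent_image[OF T, of "\<phi> ` J"] J\<psi>(2) J(4) by simp
    moreover have "\<forall>x\<in>J \<union> {}. \<exists>c. c \<noteq> 0 \<and> \<psi> x = fscale c (T (\<phi> x))"
      using TJ by (intro ballI exI[of _ 1]) simp
    ultimately show ?case using T by blast
  next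
    case (insert e A)
    then obtain T where T: "Vector_Spaces.linear fscale fscale T"
      and inj: "inj_on T (fvs.span (\<phi> ` E))"
      and scaled: "\<And>x. x \<in> J \<union> A \<Longrightarrow> \<exists>c. c \<noteq> 0 \<and> \<psi> x = fscale c (T (\<phi> x))"
      by auto
    \<comment> \<open>The images treated so far. Their spans agree with those of the
      \<open>\<psi>\<close>-vectors, so equality of the two matroids puts
      \<open>T (\<phi> e)\<close> and \<open>\<psi> e\<close> into the same spans of subsets of
      \<open>S\<close>.\<close>
    define S where "S = (\<lambda>x. T (\<phi> x)) ` (J \<union> A)"
    have JA: "J \<union> A \<subseteq> E" and e: "e \<in> E" using insert.prems J(1) by auto
    have e_JA: "\<phi> e \<in> fvs.span (\<phi> ` (J \<union> A))"
      using J(4) e fvs.span_base[of "\<phi> e" "\<phi> ` E"] fvs.span_mono[of "\<phi> ` J" "\<phi> ` (J \<union> A)"] by auto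
    have spT: "T (\<phi> e) \<in> fvs.span ((\<lambda>x. T (\<phi> x)) ` X) \<longleftrightarrow> \<psi> e \<in> fvs.span ((\<lambda>x. T (\<phi> x)) ` X)"
      if X: "X \<subseteq> J \<union> A" for X
    proof -
      have XE: "\<phi> ` X \<subseteq> fvs.span (\<phi> ` E)"
        using X JA by (meson fvs.span_superset image_mono order_trans)
      have "T (\<phi> e) \<in> fvs.span (T ` \<phi> ` X) \<longleftrightarrow> \<phi> e \<in> fvs.span (\<phi> ` X)"
        by (rule linear_image_span_iff[OF T inj])
          (use e in \<open>simp_all add: XE fvs.span_base\<close>)
      also have "\<dots> \<longleftrightarrow> \<psi> e \<in> fvs.span (\<psi> ` X)"
        using vmat_eq_span[OF eq, of X e] vmat_eq_span[OF eq[symmetric], of X e] X JA e by blast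
      also have "fvs.span (\<psi> ` X) = fvs.span ((\<lambda>x. T (\<phi> x)) ` X)"
        by (rule span_image_scaled) (use scaled X in blast)
      finally show ?thesis by (simp add: image_image)
    qed
    have u: "T (\<phi> e) \<in> fvs.span S"
      using e_JA fvp.linear_span_image[OF T, of "\<phi> ` (J \<union> A)"] by (auto simp: S_def image_image)
    then have v: "\<psi> e \<in> fvs.span S" using spT[of "J \<union> A"] by (simp add: S_def)
    have "T (\<phi> e) \<in> fvs.span Y \<longleftrightarrow> \<psi> e \<in> fvs.span Y" if "Y \<subseteq> S" for Y
      using that spT unfolding S_def subset_image_iff by blast
    from same_spans_projective[OF q u v this]
    obtain U where U: "Vector_Spaces.linear fscale fscale U" "inj_on U (fvs.span S)"
      "U (T (\<phi> e)) = \<psi> e" and Us: "\<And>x. x \<in> S \<Longrightarrow> U x = x \<or> U x = - x"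
      by blast
    \<comment> \<open>\<open>J\<close> spans from the start, so \<open>S\<close> spans the full
      image of \<open>T\<close>, and injectivity of \<open>U\<close> there is enough for the
      composition.\<close>
    have "fvs.span (\<phi> ` E) = fvs.span (\<phi> ` (J \<union> A))"
    proof
      show "fvs.span (\<phi> ` E) \<subseteq> fvs.span (\<phi> ` (J \<union> A))"
        unfolding J(4)[symmetric] by (intro fvs.span_mono image_mono) simp
      show "fvs.span (\<phi> ` (J \<union> A)) \<subseteq> fvs.span (\<phi> ` E)"
        by (intro fvs.span_mono image_mono JA)
    qed
    then have "T ` fvs.span (\<phi> ` E) = fvs.span S"
      using fvp.linear_span_image[OF T, of "\<phi> ` (J \<union> A)"] by (simp add: S_def image_image)
    then have "inj_on (U \<circ> T) (fvs.span (\<phi> ` E))"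
      using inj U(2) by (simp add: comp_inj_on)
    moreover have "Vector_Spaces.linear fscale fscale (U \<circ> T)"
      by (rule Vector_Spaces.linear_compose[OF T U(1)])
    moreover have "\<exists>c. c \<noteq> 0 \<and> \<psi> x = fscale c ((U \<circ> T) (\<phi> x))" if x: "x \<in> J \<union> insert e A" for x
    proof (cases "x = e")
      case True
      then show ?thesis using U(3) by (intro exI[of _ 1]) simp
    next
      case False
      then have x: "x \<in> J \<union> A" using x by simp
      then obtain c where c: "c \<noteq> 0" "\<psi> x = fscale c (T (\<phi> x))" using scaled by blast
      have "T (\<phi> x) \<in> S" using x by (auto simp: S_def)
      then consider "U (T (\<phi> x)) = T (\<phi> x)" | "U (T (\<phi> x)) = - T (\<phi> x)" using Us by blast
      then show ?thesis
      proof cases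
        case 1
        then have "\<psi> x = fscale c ((U \<circ> T) (\<phi> x))" using c(2) by simp
        then show ?thesis using c(1) by blast
      next
        case 2
        then have "\<psi> x = fscale (- c) ((U \<circ> T) (\<phi> x))" using c(2) by simp
        then show ?thesis using c(1) by (intro exI[of _ "- c"]) simp
      qed
    qed
    ultimately show ?case by (intro exI[of _ "U \<circ> T"] conjI ballI)
  qed
  from this[OF E subset_refl] show ?thesis using J(1) by (simp add: Un_absorb1)
qed

section \<open>Rank, flats and simplicity in terms of spans\<close>

lemma rank_of_vmat:
  assumes E: "finite E" and X: "X \<subseteq> E"
  shows "rank_of (vmat \<phi> E) X = fvs.dim (\<phi> ` X)"
proof -
  obtain J where J: "J \<subseteq> X" "inj_on \<phi> J" "fvs.independent (\<phi> ` J)" "fvs.span (\<phi> ` J) = fvs.span (\<phi> ` X)"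
    by (rule exists_independent_spanning_family)
  let ?I = "{I \<in> indeps (vmat \<phi> E). I \<subseteq> X}"
  have "Max (card ` ?I) = card J"
  proof (rule Max_eqI)
    have "?I \<subseteq> Pow E" using X by auto
    then show "finite (card ` ?I)" using E by (meson finite_Pow_iff finite_imageI finite_subset)
    have "J \<in> ?I"
      using J(1-3) X unfolding indeps_vmat by blast
    then show "card J \<in> card ` ?I" by (rule imageI)
    fix k assume "k \<in> card ` ?I"
    then obtain I where I: "I \<subseteq> X" "inj_on \<phi> I" "fvs.independent (\<phi> ` I)" "k = card I"
      unfolding indeps_vmat by blast
    have "finite (\<phi> ` J)" using J(1) X E by (meson finite_imageI finite_subset)
    moreover have "\<phi> ` I \<subseteq> fvs.span (\<phi> ` J)"
      unfolding J(4) using I(1) by (meson fvs.span_superset image_mono order_trans)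
    ultimately have "card (\<phi> ` I) \<le> card (\<phi> ` J)"
      using fvs.independent_span_bound I(3) by blast
    then show "k \<le> card J" using I(2,4) J(2) by (simp only: card_image)
  qed
  moreover have "fvs.dim (\<phi> ` X) = card (\<phi> ` J)"
    by (rule fvs.dim_eq_card[OF J(4,3)])
  ultimately show ?thesis using J(2) by (simp only: rank_of_def card_image)
qed

lemma mrank_vmat: "finite E \<Longrightarrow> mrank (vmat \<phi> E) = fvs.dim (\<phi> ` E)"
  unfolding mrank_def by (simp add: rank_of_vmat)

lemma basis_card_dim:
  assumes "finite V"
  obtains B where "finite B" "card B = fvs.dim V" "fvs.span B = fvs.span V" "fvs.independent B"
proof -
  obtain B where B: "B \<subseteq> V" "fvs.independent B" "V \<subseteq> fvs.span B"
    by (rule fvs.maximal_independent_subset)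
  have spB: "fvs.span B = fvs.span V"
    using B by (metis fvs.span_mono fvs.span_span subset_antisym)
  have "card B = fvs.dim V" using fvs.dim_eq_card[OF spB B(2)] by simp
  then show ?thesis using that finite_subset[OF B(1) assms] spB B(2) by blast
qed

lemma dim_insert_less_iff:
  assumes "finite V"
  shows "fvs.dim V < fvs.dim (insert v V) \<longleftrightarrow> v \<notin> fvs.span V"
proof
  assume v: "v \<notin> fvs.span V"
  obtain B where B: "finite B" "card B = fvs.dim V" and spB: "fvs.span B = fvs.span V"
    and ind: "fvs.independent B"
    by (rule basis_card_dim[OF assms])
  have "fvs.independent (insert v B)"
    using v spB ind by (intro fvs.independent_insertI) simp_all
  moreover have "fvs.span (insert v B) = fvs.span (insert v V)"
    using spB by (simp add: fvs.span_insert)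
  ultimately have "fvs.dim (insert v V) = card (insert v B)"
    using fvs.dim_eq_card by blast
  moreover have "v \<notin> B" using v spB fvs.span_base by blast
  ultimately show "fvs.dim V < fvs.dim (insert v V)" using B by simp
next
  assume less: "fvs.dim V < fvs.dim (insert v V)"
  show "v \<notin> fvs.span V"
  proof
    assume "v \<in> fvs.span V"
    then have "fvs.dim (insert v V) = fvs.dim V"
      by (intro fvs.span_eq_dim fvs.span_redundant)
    then show False using less by simp
  qed
qed

lemma flat_vmat:
  assumes "finite E"
  shows "flat (vmat \<phi> E) X \<longleftrightarrow> X \<subseteq> E \<and> (\<forall>e\<in>E - X. \<phi> e \<notin> fvs.span (\<phi> ` X))"
proof -
  have "rank_of (vmat \<phi> E) X < rank_of (vmat \<phi> E) (insert e X) \<longleftrightarrow> \<phi> e \<notin> fvs.span (\<phi> ` X)"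
    if "X \<subseteq> E" "e \<in> E" for e
  proof -
    have "finite (\<phi> ` X)" using that(1) assms finite_subset by blast
    from dim_insert_less_iff[OF this, of "\<phi> e"] show ?thesis
      using that assms by (simp add: rank_of_vmat)
  qed
  then show ?thesis unfolding flat_def by auto
qed

lemma is_matroid_vmat:
  assumes E: "finite E"
  shows "is_matroid (vmat \<phi> E)"
  unfolding is_matroid_def
proof (intro conjI ballI allI impI)
  fix I J assume I: "I \<in> indeps (vmat \<phi> E)" and J: "J \<subseteq> I"
  then show "J \<in> indeps (vmat \<phi> E)"
    unfolding indeps_vmat
    by (meson fvs.independent_mono image_mono inj_on_subset order_trans)
next
  fix I J assume I: "I \<in> indeps (vmat \<phi> E)" and J: "J \<in> indeps (vmat \<phi> E)" and less: "card I < card J"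
  have "\<not> \<phi> ` J \<subseteq> fvs.span (\<phi> ` I)"
  proof
    assume "\<phi> ` J \<subseteq> fvs.span (\<phi> ` I)"
    moreover have "finite (\<phi> ` I)" using I E finite_subset unfolding indeps_vmat by blast
    ultimately have "card (\<phi> ` J) \<le> card (\<phi> ` I)"
      using fvs.independent_span_bound J unfolding indeps_vmat by blast
    then show False using I J less by (simp add: card_image indeps_vmat)
  qed
  then obtain e where e: "e \<in> J" "\<phi> e \<notin> fvs.span (\<phi> ` I)" by blast
  have "e \<notin> I" using e(2) fvs.span_base by blast
  moreover have "insert e I \<in> indeps (vmat \<phi> E)"
    using independent_family_insert[of \<phi> I e] I J e unfolding indeps_vmat by blast
  ultimately show "\<exists>e\<in>J - I. insert e I \<in> indeps (vmat \<phi> E)" using e(1) by blast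
qed (use E fvs.independent_empty in \<open>auto simp: indeps_vmat\<close>)

text \<open>The last two conditions say that the elements are represented by distinct points of a
  projective geometry, which amounts to simplicity of \<open>vmat\<close>.\<close>

definition vrep :: "('e \<Rightarrow> nat \<Rightarrow> 'f::field) \<Rightarrow> 'e set \<Rightarrow> bool" where
  "vrep \<phi> E \<longleftrightarrow> finite E \<and> (\<exists>n. \<phi> ` E \<subseteq> coord_space n) \<and> (\<forall>x\<in>E. \<phi> x \<noteq> 0) \<and>
     (\<forall>x\<in>E. \<forall>y\<in>E. x \<noteq> y \<longrightarrow> \<phi> x \<notin> fvs.span {\<phi> y})"

lemma vrep_subset: "vrep \<phi> E \<Longrightarrow> X \<subseteq> E \<Longrightarrow> vrep \<phi> X"
  unfolding vrep_def by (elim conjE exE, intro conjI exI) (blast intro: finite_subset)+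

lemma simple_vmat:
  "simple (vmat \<phi> E) \<longleftrightarrow> (\<forall>x\<in>E. \<phi> x \<noteq> 0) \<and> (\<forall>x\<in>E. \<forall>y\<in>E. x \<noteq> y \<longrightarrow> \<phi> x \<notin> fvs.span {\<phi> y})"
proof -
  have *: "{x, y} \<in> indeps (vmat \<phi> E) \<longleftrightarrow>
      (if x = y then \<phi> x \<noteq> 0 else \<phi> x \<notin> fvs.span {\<phi> y} \<and> \<phi> y \<notin> fvs.span {\<phi> x})"
    if "x \<in> E" "y \<in> E" for x y
  proof (cases "x = y")
    case True
    then show ?thesis using that by (simp add: indeps_vmat)
  next
    case False
    then have "{x, y} - {x} = {y}" "{x, y} - {y} = {x}" by auto
    then show ?thesis using that False unfolding indeps_vmat independent_family_iff by simp
  qed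
  show ?thesis
    unfolding simple_def ground_vmat
  proof (intro iffI conjI ballI impI; (elim conjE)?)
    fix x assume "\<forall>x\<in>E. \<forall>y\<in>E. {x, y} \<in> indeps (vmat \<phi> E)" "x \<in> E"
    then have "{x, x} \<in> indeps (vmat \<phi> E)" by blast
    then show "\<phi> x \<noteq> 0" using *[of x x] \<open>x \<in> E\<close> by simp
  next
    fix x y assume "\<forall>x\<in>E. \<forall>y\<in>E. {x, y} \<in> indeps (vmat \<phi> E)" "x \<in> E" "y \<in> E" "x \<noteq> y"
    then have "{x, y} \<in> indeps (vmat \<phi> E)" by blast
    then show "\<phi> x \<notin> fvs.span {\<phi> y}"
      using *[of x y] \<open>x \<in> E\<close> \<open>y \<in> E\<close> \<open>x \<noteq> y\<close> by simp
  next
    fix x y assume "\<forall>x\<in>E. \<phi> x \<noteq> 0" "\<forall>x\<in>E. \<forall>y\<in>E. x \<noteq> y \<longrightarrow> \<phi> x \<notin> fvs.span {\<phi> y}" "x \<in> E" "y \<in> E"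
    then show "{x, y} \<in> indeps (vmat \<phi> E)" unfolding *[OF \<open>x \<in> E\<close> \<open>y \<in> E\<close>] by simp
  qed
qed

lemma gf_matroid_vmat:
  fixes \<phi> :: "'e \<Rightarrow> nat \<Rightarrow> 'f::{field,finite}"
  assumes "vrep \<phi> E"
  shows "gf_matroid TYPE('f) (vmat \<phi> E)"
proof -
  obtain n where "\<phi> ` E \<subseteq> coord_space n" using assms by (auto simp: vrep_def)
  then have "representable TYPE('f) (vmat \<phi> E)"
    unfolding representable_def ground_vmat indeps_vmat by blast
  then show ?thesis
    using assms unfolding gf_matroid_def simple_vmat vrep_def by (simp add: is_matroid_vmat)
qed

lemma gf_matroid_obtain:
  fixes M :: "'e matroid"
  assumes M: "gf_matroid TYPE('f::{field,finite}) M"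
  obtains \<phi> :: "'e \<Rightarrow> nat \<Rightarrow> 'f::{field,finite}" where "vrep \<phi> (ground M)" "M = vmat \<phi> (ground M)"
proof -
  obtain n and \<phi> :: "'e \<Rightarrow> nat \<Rightarrow> 'f" where \<phi>: "\<phi> ` ground M \<subseteq> coord_space n"
    and ind: "\<And>X. X \<subseteq> ground M \<Longrightarrow> X \<in> indeps M \<longleftrightarrow> inj_on \<phi> X \<and> fvs.independent (\<phi> ` X)"
    using M unfolding gf_matroid_def representable_def by blast
  have mat: "is_matroid M" and simp: "simple M" using M by (auto simp: gf_matroid_def)
  have "indeps M = indeps (vmat \<phi> (ground M))"
  proof (intro set_eqI)
    fix X
    have "indeps M \<subseteq> Pow (ground M)" using mat unfolding is_matroid_def by (elim conjE)
    then have "X \<in> indeps M \<Longrightarrow> X \<subseteq> ground M" by blast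
    then show "X \<in> indeps M \<longleftrightarrow> X \<in> indeps (vmat \<phi> (ground M))"
      using ind[of X] unfolding indeps_vmat by blast
  qed
  then have M_eq: "M = vmat \<phi> (ground M)"
    by (intro matroid.expand conjI) simp_all
  then have "simple (vmat \<phi> (ground M))" using simp by metis
  moreover have "finite (ground M)" using mat unfolding is_matroid_def by (elim conjE)
  ultimately have "vrep \<phi> (ground M)"
    using \<phi> unfolding simple_vmat vrep_def by blast
  then show ?thesis using M_eq that by blast
qed

text \<open>A flat outside \<open>\<M>\<close> with the fewest elements works: a flat of a flat is a
  flat, so its proper flats are smaller competitors.\<close>

lemma exists_forbidden_flat:
  fixes \<phi> :: "'e \<Rightarrow> nat \<Rightarrow> 'f::{field,finite}"
  assumes \<phi>: "vrep \<phi> E" and notin: "vmat \<phi> E \<notin> \<M>"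
  obtains X where "flat (vmat \<phi> E) X" "vmat \<phi> X \<in> forbidden_flats TYPE('f) \<M>"
proof -
  have E: "finite E" using \<phi> by (simp add: vrep_def)
  let ?P = "\<lambda>X. flat (vmat \<phi> E) X \<and> vmat \<phi> X \<notin> \<M>"
  have "?P E" using notin E by (simp add: flat_vmat)
  from ex_has_least_nat[of ?P, OF this, of card]
  obtain X where X: "flat (vmat \<phi> E) X" "vmat \<phi> X \<notin> \<M>"
    and least: "\<And>Y. flat (vmat \<phi> E) Y \<Longrightarrow> vmat \<phi> Y \<notin> \<M> \<Longrightarrow> card X \<le> card Y"
    by blast
  have XE: "X \<subseteq> E" and X': "\<And>e. e \<in> E - X \<Longrightarrow> \<phi> e \<notin> fvs.span (\<phi> ` X)"
    using X(1) E by (auto simp: flat_vmat)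
  have fX: "finite X" using XE E finite_subset by blast
  have "restrict_to (vmat \<phi> X) Y \<in> \<M>" if Y: "flat (vmat \<phi> X) Y" "Y \<noteq> X" for Y
  proof -
    have YX: "Y \<subseteq> X" and Y': "\<And>e. e \<in> X - Y \<Longrightarrow> \<phi> e \<notin> fvs.span (\<phi> ` Y)"
      using Y(1) fX by (auto simp: flat_vmat)
    have "fvs.span (\<phi> ` Y) \<subseteq> fvs.span (\<phi> ` X)"
      using YX by (intro fvs.span_mono image_mono)
    then have "flat (vmat \<phi> E) Y"
      using X' Y' YX XE E by (simp add: flat_vmat) blast
    moreover have "card Y < card X"
      using YX Y(2) fX by (intro psubset_card_mono) auto
    ultimately have "vmat \<phi> Y \<in> \<M>" using least[of Y] by linarith
    then show ?thesis using YX by (simp add: restrict_to_vmat)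
  qed
  then have "vmat \<phi> X \<in> forbidden_flats TYPE('f) \<M>"
    using X(2) gf_matroid_vmat[OF vrep_subset[OF \<phi> XE]]
    unfolding forbidden_flats_def by simp
  then show ?thesis using that X(1) by blast
qed

section \<open>Counting non-elements\<close>

lemma subspace_coord_space: "fvs.subspace (coord_space n)"
  by (rule fvs.subspaceI) (auto simp: coord_space_def fscale_def)

lemma finite_pg_points: "finite (pg_points n :: (nat \<Rightarrow> 'f::{field,finite}) set set)"
proof -
  have "finite {v :: nat \<Rightarrow> 'f. \<forall>i. (i \<in> {..<n} \<longrightarrow> v i \<in> UNIV) \<and> (i \<notin> {..<n} \<longrightarrow> v i = 0)}"
    by (rule finite_set_of_finite_funs) auto
  moreover have "coord_space n = {v :: nat \<Rightarrow> 'f. \<forall>i. (i \<in> {..<n} \<longrightarrow> v i \<in> UNIV) \<and> (i \<notin> {..<n} \<longrightarrow> v i = 0)}"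
    by (auto simp: coord_space_def)
  ultimately have "finite (coord_space n :: (nat \<Rightarrow> 'f) set)" by simp
  moreover have "pg_points n \<subseteq> (\<lambda>v. fvs.span {v}) ` (coord_space n :: (nat \<Rightarrow> 'f) set)"
    by (auto simp: pg_points_def)
  ultimately show ?thesis using finite_surj by blast
qed

definition unit_vector :: "nat \<Rightarrow> nat \<Rightarrow> 'f::field" where
  "unit_vector i = (\<lambda>j. if j = i then 1 else 0)"

lemma independent_unit_vectors:
  "inj_on (unit_vector :: nat \<Rightarrow> nat \<Rightarrow> 'f::field) A \<and> fvs.independent ((unit_vector :: nat \<Rightarrow> nat \<Rightarrow> 'f) ` A)"
  unfolding independent_family_iff
proof
  fix i assume "i \<in> A"
  have "fvs.subspace {v :: nat \<Rightarrow> 'f. v i = 0}"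
    by (rule fvs.subspaceI) (auto simp: fscale_def)
  moreover have "unit_vector ` (A - {i}) \<subseteq> {v :: nat \<Rightarrow> 'f. v i = 0}"
    by (auto simp: unit_vector_def)
  ultimately have "fvs.span (unit_vector ` (A - {i})) \<subseteq> {v :: nat \<Rightarrow> 'f. v i = 0}"
    by (intro fvs.span_minimal)
  moreover have "unit_vector i \<notin> {v :: nat \<Rightarrow> 'f. v i = 0}"
    by (simp add: unit_vector_def)
  ultimately show "(unit_vector i :: nat \<Rightarrow> 'f) \<notin> fvs.span (unit_vector ` (A - {i}))" by blast
qed

text \<open>The analogue of \<open>pg_points\<close> for a subspace that need not be a coordinate
  space, such as the span of a flat.\<close>

definition points_of :: "(nat \<Rightarrow> 'f::field) set \<Rightarrow> (nat \<Rightarrow> 'f) set set" where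
  "points_of W = {fvs.span {v} | v. v \<in> W \<and> v \<noteq> 0}"

text \<open>Sending a basis of the span to unit vectors gives an injective linear map into
  \<open>coord_space\<close>, which carries points to points injectively.\<close>

lemma card_points_of_span:
  fixes V :: "(nat \<Rightarrow> 'f::{field,finite}) set"
  assumes "finite V"
  shows "finite (points_of (fvs.span V)) \<and>
         card (points_of (fvs.span V)) \<le> card (pg_points (fvs.dim V) :: (nat \<Rightarrow> 'f) set set)"
proof -
  define r where "r = fvs.dim V"
  obtain B where fB: "finite B" and r: "card B = r" and spB: "fvs.span B = fvs.span V"
    and ind: "fvs.independent B"
    unfolding r_def by (rule basis_card_dim[OF assms])
  obtain g where g: "bij_betw g B {0..<r}"
    using ex_bij_betw_finite_nat[OF fB] r by auto
  obtain T where T: "Vector_Spaces.linear fscale fscale T"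
    and Tb: "\<And>b. b \<in> B \<Longrightarrow> T b = (unit_vector (g b) :: nat \<Rightarrow> 'f)"
    using fvp.linear_independent_extend[OF ind, of "\<lambda>b. unit_vector (g b)"] by blast
  have TB: "T ` B = unit_vector ` {0..<r}"
  proof -
    have "T ` B = unit_vector ` g ` B" unfolding image_image by (rule image_cong[OF refl Tb])
    then show ?thesis using bij_betw_imp_surj_on[OF g] by simp
  qed
  have unit: "inj_on (unit_vector :: nat \<Rightarrow> nat \<Rightarrow> 'f) {0..<r}"
    "fvs.independent ((unit_vector :: nat \<Rightarrow> nat \<Rightarrow> 'f) ` {0..<r})"
    using independent_unit_vectors by blast+
  have "inj_on T B"
  proof (rule inj_onI)
    fix b c assume bc: "b \<in> B" "c \<in> B" "T b = T c"
    then have "(unit_vector (g b) :: nat \<Rightarrow> 'f) = unit_vector (g c)" using Tb by simp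
    then have "g b = g c"
      using inj_onD[OF unit(1)] bij_betwE[OF g] bc(1,2) by blast
    then show "b = c" using bij_betw_imp_inj_on[OF g] bc(1,2) by (simp only: inj_on_eq_iff)
  qed
  then have inj: "inj_on T (fvs.span V)"
    using fvp.linear_inj_on_span_independent_image[OF T, of B] unit(2) TB spB by simp
  have "unit_vector ` {0..<r} \<subseteq> (coord_space r :: (nat \<Rightarrow> 'f) set)"
    by (auto simp: unit_vector_def coord_space_def)
  then have "fvs.span (unit_vector ` {0..<r}) \<subseteq> (coord_space r :: (nat \<Rightarrow> 'f) set)"
    using subspace_coord_space by (rule fvs.span_minimal)
  then have TV: "T ` fvs.span V \<subseteq> coord_space r"
    using fvp.linear_span_image[OF T, of B] TB spB by simp
  have sub: "points_of (fvs.span V) \<subseteq> Pow (fvs.span V)"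
  proof
    fix P assume "P \<in> points_of (fvs.span V)"
    then obtain v where v: "v \<in> fvs.span V" "P = fvs.span {v}" unfolding points_of_def by blast
    have "P \<subseteq> fvs.span V"
      unfolding v(2) by (rule fvs.span_minimal) (use v(1) in simp_all)
    then show "P \<in> Pow (fvs.span V)" by (rule PowI)
  qed
  have img: "(`) T ` points_of (fvs.span V) \<subseteq> pg_points r"
  proof (rule image_subsetI)
    fix P assume "P \<in> points_of (fvs.span V)"
    then obtain v where v: "v \<in> fvs.span V" "v \<noteq> 0" "P = fvs.span {v}"
      unfolding points_of_def by blast
    have "T ` P = fvs.span {T v}" using fvp.linear_span_image[OF T, of "{v}"] v by simp
    moreover have "T v \<in> coord_space r" using TV v by blast
    moreover have "T v \<noteq> 0"
      using inj_on_eq_iff[OF inj v(1) fvs.span_zero] fvp.linear_0[OF T] v(2) by simp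
    ultimately show "T ` P \<in> pg_points r" unfolding pg_points_def by blast
  qed
  have inj': "inj_on ((`) T) (points_of (fvs.span V))"
    by (rule inj_on_subset[OF inj_on_image_Pow[OF inj] sub])
  show ?thesis
    unfolding r_def[symmetric]
    by (intro conjI inj_on_finite[OF inj' img] card_inj_on_le[OF inj' img] finite_pg_points)
qed

text \<open>Distinct elements give distinct points by simplicity, so exactly \<open>card X\<close>
  points are removed from the geometry spanned by \<open>X\<close>. Those left are the
  non-elements.\<close>

lemma card_nonelements_le:
  fixes \<phi> :: "'e \<Rightarrow> nat \<Rightarrow> 'f::{field,finite}"
  assumes \<phi>: "vrep \<phi> X"
  shows "finite (points_of (fvs.span (\<phi> ` X)) - (\<lambda>x. fvs.span {\<phi> x}) ` X) \<and>
         card (points_of (fvs.span (\<phi> ` X)) - (\<lambda>x. fvs.span {\<phi> x}) ` X) \<le> num_nonelements TYPE('f) (vmat \<phi> X)"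
proof -
  have X: "finite X" using \<phi> by (simp add: vrep_def)
  have "inj_on (\<lambda>x. fvs.span {\<phi> x}) X"
  proof (rule inj_onI, rule ccontr)
    fix x y assume "x \<in> X" "y \<in> X" "fvs.span {\<phi> x} = fvs.span {\<phi> y}" "x \<noteq> y"
    moreover have "\<phi> x \<in> fvs.span {\<phi> x}" by (rule fvs.span_base) simp
    ultimately show False using \<phi> unfolding vrep_def by metis
  qed
  then have "card ((\<lambda>x. fvs.span {\<phi> x}) ` X) = card X" by (rule card_image)
  moreover have "(\<lambda>x. fvs.span {\<phi> x}) ` X \<subseteq> points_of (fvs.span (\<phi> ` X))"
    using \<phi> fvs.span_base unfolding points_of_def vrep_def by blast
  ultimately show ?thesis
    using card_points_of_span[of "\<phi> ` X"] X
    by (simp add: num_nonelements_def mrank_vmat card_Diff_subset diff_le_mono)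
qed

section \<open>Single-element extensions\<close>

lemma indeps_vmat_pullback:
  assumes "inj_on h A" "X \<subseteq> A"
  shows "X \<in> indeps (vmat (\<chi> \<circ> h) A) \<longleftrightarrow> h ` X \<in> indeps (vmat \<chi> (h ` A))"
  using assms comp_inj_on_iff[OF inj_on_subset[OF assms], of \<chi>]
  unfolding indeps_vmat image_comp[symmetric] by blast

lemma vrep_pullback:
  assumes h: "bij_betw h A E" and \<chi>: "vrep \<chi> E"
  shows "vrep (\<chi> \<circ> h) A"
proof -
  have hA: "h ` A = E" and inj: "inj_on h A" using h by (auto simp: bij_betw_def)
  have "finite A" using \<chi> bij_betw_finite[OF h] by (simp add: vrep_def)
  moreover have "(\<chi> \<circ> h) ` A = \<chi> ` E" unfolding image_comp[symmetric] hA ..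
  moreover have "h x \<in> E" if "x \<in> A" for x using hA that by blast
  moreover have "h x \<noteq> h y" if "x \<in> A" "y \<in> A" "x \<noteq> y" for x y
    using inj that by (simp add: inj_on_eq_iff)
  ultimately show ?thesis using \<chi> unfolding vrep_def comp_apply by (simp only:) blast
qed

lemma delete_vmat: "e \<notin> H \<Longrightarrow> delete (vmat \<chi> (insert e H)) e = vmat \<chi> H"
  unfolding delete_def ground_vmat
  by (subst restrict_to_vmat) auto

text \<open>The extension provided by \<open>add_class\<close> is known only up to isomorphism. It
  is carried over to the labels \<open>insert e H\<close>, so that deleting \<open>e\<close> gives
  back \<open>vmat \<phi> H\<close> itself, though with another representation
  \<open>\<psi>\<close>.\<close>

lemma extension_relabel:
  fixes \<M> :: "'e matroid set" and \<phi> :: "'e \<Rightarrow> nat \<Rightarrow> 'f::{field,finite}"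
  assumes cls: "gf_class TYPE('f) \<M>" and N: "N \<in> \<M>" "d \<in> ground N"
    and iso: "matroid_iso (delete N d) (vmat \<phi> H)" and e: "e \<notin> H"
  obtains \<psi> :: "'e \<Rightarrow> nat \<Rightarrow> 'f"
  where "vrep \<psi> (insert e H)" "vmat \<psi> H = vmat \<phi> H" "vmat \<psi> (insert e H) \<in> \<M>"
proof -
  have "gf_matroid TYPE('f) N" using cls N(1) unfolding gf_class_def by blast
  then obtain \<chi> :: "'e \<Rightarrow> nat \<Rightarrow> 'f" where \<chi>: "vrep \<chi> (ground N)" and N_eq: "N = vmat \<chi> (ground N)"
    by (rule gf_matroid_obtain)
  define D where "D = ground N - {d}"
  have gN: "ground N = insert d D" and d: "d \<notin> D" using N(2) by (auto simp: D_def)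
  have \<chi>': "vrep \<chi> (insert d D)" and N_eq': "N = vmat \<chi> (insert d D)"
    using \<chi> N_eq unfolding gN by simp_all
  have "delete N d = vmat \<chi> D" unfolding N_eq' by (rule delete_vmat[OF d])
  then obtain f where f: "bij_betw f D H"
    and f_ind: "\<And>X. X \<subseteq> D \<Longrightarrow> X \<in> indeps (vmat \<chi> D) \<longleftrightarrow> f ` X \<in> indeps (vmat \<phi> H)"
    using iso unfolding matroid_iso_def by auto
  \<comment> \<open>The inverse isomorphism, extended by sending the new label \<open>e\<close> to
    the deleted element \<open>d\<close>. Pulling \<open>\<chi>\<close> back along it gives the
    required \<open>\<psi>\<close>.\<close>
  define h where "h = (inv_into D f)(e := d)"
  have hH: "h x = inv_into D f x" if "x \<in> H" for x using that e by (auto simp: h_def)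
  have h_bij: "bij_betw h H D"
    using bij_betw_inv_into[OF f] by (rule bij_betw_cong[THEN iffD1, rotated]) (simp add: hH)
  have he: "h e = d" by (simp add: h_def)
  have h: "bij_betw h (insert e H) (insert d D)"
    using notIn_Un_bij_betw[of e H h D] e d h_bij he by simp
  have fh: "f ` h ` X = X" if "X \<subseteq> H" for X
  proof -
    have "f (h x) = x" if "x \<in> X" for x
      using hH[of x] that \<open>X \<subseteq> H\<close> bij_betw_inv_into_right[OF f, of x] by auto
    then show ?thesis unfolding image_image by simp
  qed
  have ind: "X \<in> indeps (vmat (\<chi> \<circ> h) H) \<longleftrightarrow> X \<in> indeps (vmat \<phi> H)" if X: "X \<subseteq> H" for X
  proof -
    have "X \<in> indeps (vmat (\<chi> \<circ> h) H) \<longleftrightarrow> h ` X \<in> indeps (vmat \<chi> D)"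
      using indeps_vmat_pullback[OF bij_betw_imp_inj_on[OF h_bij] X, of \<chi>]
      unfolding bij_betw_imp_surj_on[OF h_bij] .
    also have "\<dots> \<longleftrightarrow> f ` h ` X \<in> indeps (vmat \<phi> H)"
      by (rule f_ind) (use X bij_betw_imp_surj_on[OF h_bij] in blast)
    finally show ?thesis unfolding fh[OF X] .
  qed
  have "indeps (vmat (\<chi> \<circ> h) H) = indeps (vmat \<phi> H)"
  proof (intro set_eqI iffI)
    fix X assume X: "X \<in> indeps (vmat (\<chi> \<circ> h) H)"
    then have "X \<subseteq> H" unfolding indeps_vmat by blast
    then show "X \<in> indeps (vmat \<phi> H)" using ind X by blast
  next
    fix X assume X: "X \<in> indeps (vmat \<phi> H)"
    then have "X \<subseteq> H" unfolding indeps_vmat by blast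
    then show "X \<in> indeps (vmat (\<chi> \<circ> h) H)" using ind X by blast
  qed
  then have eq: "vmat (\<chi> \<circ> h) H = vmat \<phi> H"
    by (intro matroid.expand conjI) simp_all
  have vrep: "vrep (\<chi> \<circ> h) (insert e H)"
    by (rule vrep_pullback[OF h \<chi>'])
  have "matroid_iso N (vmat (\<chi> \<circ> h) (insert e H))"
    unfolding matroid_iso_def ground_vmat gN
  proof (intro exI conjI allI impI)
    let ?g = "inv_into (insert e H) h"
    show g: "bij_betw ?g (insert d D) (insert e H)"
      by (rule bij_betw_inv_into[OF h])
    fix X assume X: "X \<subseteq> insert d D"
    have "?g ` X \<subseteq> insert e H" using X bij_betw_imp_surj_on[OF g] by blast
    from indeps_vmat_pullback[OF bij_betw_imp_inj_on[OF h] this, of \<chi>]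
    have "?g ` X \<in> indeps (vmat (\<chi> \<circ> h) (insert e H)) \<longleftrightarrow> h ` ?g ` X \<in> indeps N"
      unfolding bij_betw_imp_surj_on[OF h] N_eq'[symmetric] .
    also have "h ` ?g ` X = X"
      using image_inv_into_cancel[OF bij_betw_imp_surj_on[OF h] X] .
    finally show "X \<in> indeps N \<longleftrightarrow> ?g ` X \<in> indeps (vmat (\<chi> \<circ> h) (insert e H))" by blast
  qed
  moreover have "is_matroid (vmat (\<chi> \<circ> h) (insert e H))"
    using vrep by (intro is_matroid_vmat) (simp add: vrep_def)
  ultimately have "vmat (\<chi> \<circ> h) (insert e H) \<in> \<M>"
    using cls N(1) unfolding gf_class_def by blast
  then show ?thesis using that vrep eq by blast
qed

text \<open>Unique representability carries \<open>\<psi>\<close> to \<open>\<phi>\<close> on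
  \<open>H\<close>. As the vector of \<open>e\<close> lies in the span of the vectors of
  \<open>X\<close>, the same linear map also places it, and \<open>p\<close> is its image.\<close>

lemma extension_vmat:
  fixes \<phi> \<psi> :: "'e \<Rightarrow> nat \<Rightarrow> 'f::{field,finite}"
  assumes q: "CARD('f) \<in> {2, 3}" and \<psi>: "vrep \<psi> (insert e H)" and e: "e \<notin> H"
    and eq: "vmat \<psi> H = vmat \<phi> H" and X: "X \<subseteq> H" and sp: "\<psi> e \<in> fvs.span (\<psi> ` X)"
  obtains p where "p \<in> fvs.span (\<phi> ` X)" "p \<noteq> 0"
    "vmat (\<phi>(e := p)) (insert e H) = vmat \<psi> (insert e H)"
proof -
  have "finite H" using \<psi> by (simp add: vrep_def)
  from unique_representation[OF q this eq]
  obtain T where T: "Vector_Spaces.linear fscale fscale T" and inj: "inj_on T (fvs.span (\<psi> ` H))"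
    and scaled: "\<And>x. x \<in> H \<Longrightarrow> \<exists>c. c \<noteq> 0 \<and> \<phi> x = fscale c (T (\<psi> x))"
    by blast
  have spH: "\<psi> e \<in> fvs.span (\<psi> ` H)"
    using sp fvs.span_mono[OF image_mono[OF X]] by blast
  have "T (\<psi> e) \<in> T ` fvs.span (\<psi> ` X)" using sp by (rule imageI)
  also have "\<dots> = fvs.span ((\<lambda>x. T (\<psi> x)) ` X)"
    unfolding fvp.linear_span_image[OF T, symmetric] image_image ..
  also have "\<dots> = fvs.span (\<phi> ` X)"
    by (rule span_image_scaled[symmetric]) (use scaled X in blast)
  finally have p: "T (\<psi> e) \<in> fvs.span (\<phi> ` X)" .
  have "\<psi> e \<noteq> 0" using \<psi> by (simp add: vrep_def)
  then have p0: "T (\<psi> e) \<noteq> 0"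
    using inj_on_eq_iff[OF inj spH fvs.span_zero] fvp.linear_0[OF T] by simp
  have "vmat (\<phi>(e := T (\<psi> e))) (insert e H) = vmat \<psi> (insert e H)"
  proof (rule vmat_linear_image[OF T])
    show "inj_on T (fvs.span (\<psi> ` insert e H))"
      using inj fvs.span_redundant[OF spH] by simp
    fix x assume x: "x \<in> insert e H"
    show "\<exists>c. c \<noteq> 0 \<and> (\<phi>(e := T (\<psi> e))) x = fscale c (T (\<psi> x))"
    proof (cases "x = e")
      case True
      then show ?thesis by (intro exI[of _ 1]) simp
    next
      case False
      then show ?thesis using scaled x by simp
    qed
  qed
  then show ?thesis using that p p0 by blast
qed

section \<open>Flats of configurations and hereditary classes\<close>

lemma flat_vmat_subset:
  assumes "finite E" "flat (vmat \<phi> E) X" "X \<subseteq> H" "H \<subseteq> E"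
  shows "flat (vmat \<phi> H) X"
proof -
  have "finite H" using assms finite_subset by blast
  then show ?thesis
    using assms(2-4) unfolding flat_vmat[OF assms(1)] flat_vmat[OF \<open>finite H\<close>] by blast
qed

lemma flat_vmat_closure:
  assumes "finite E"
  shows "flat (vmat \<phi> E) {x \<in> E. \<phi> x \<in> fvs.span W}"
proof -
  have "fvs.span (\<phi> ` {x \<in> E. \<phi> x \<in> fvs.span W}) \<subseteq> fvs.span W"
    by (rule fvs.span_minimal) auto
  then show ?thesis unfolding flat_vmat[OF assms] by blast
qed

lemma hereditary_vmat:
  assumes her: "hereditary \<M>" and M: "vmat \<phi> E \<in> \<M>" and X: "flat (vmat \<phi> E) X"
  shows "vmat \<phi> X \<in> \<M>"
proof -
  have "restrict_to (vmat \<phi> E) X \<in> \<M>" using her M X unfolding hereditary_def by blast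
  moreover have "X \<subseteq> E" using X unfolding flat_def by simp
  ultimately show ?thesis by (simp add: restrict_to_vmat)
qed

lemma vmat_fun_upd: "e \<notin> X \<Longrightarrow> vmat (\<phi>(e := p)) X = vmat \<phi> X"
  by (rule vmat_cong) auto

text \<open>If the new point were outside the span of \<open>X\<close>, then \<open>X\<close> would
  remain a flat of the extension and would give a member of \<open>\<M>\<close> by heredity. So the
  point lies in the span, where \<open>extension_vmat\<close> applies.\<close>

lemma add_class_extension:
  fixes \<M> :: "'e matroid set" and \<phi> :: "'e \<Rightarrow> nat \<Rightarrow> 'f::{field,finite}"
  assumes q: "CARD('f) \<in> {2, 3}" and cls: "gf_class TYPE('f) \<M>" and her: "hereditary \<M>"
    and H: "finite H" and e: "e \<notin> H" and add: "vmat \<phi> H \<in> add_class TYPE('f) \<M>"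
    and X: "flat (vmat \<phi> H) X" "vmat \<phi> X \<notin> \<M>"
  obtains p where "p \<in> fvs.span (\<phi> ` X)" "p \<noteq> 0" "vmat (\<phi>(e := p)) (insert e H) \<in> \<M>"
proof -
  have "vmat \<phi> H \<notin> \<M>" using hereditary_vmat[OF her _ X(1)] X(2) by blast
  then obtain N d where N: "N \<in> \<M>" "d \<in> ground N" and iso: "matroid_iso (delete N d) (vmat \<phi> H)"
    using add unfolding add_class_def by blast
  obtain \<psi> :: "'e \<Rightarrow> nat \<Rightarrow> 'f" where \<psi>: "vrep \<psi> (insert e H)"
    and eq: "vmat \<psi> H = vmat \<phi> H" and in_M: "vmat \<psi> (insert e H) \<in> \<M>"
    by (rule extension_relabel[OF cls N iso e])
  have XH: "X \<subseteq> H" using X(1) unfolding flat_vmat[OF H] by blast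
  have "\<psi> e \<in> fvs.span (\<psi> ` X)"
  proof (rule ccontr)
    assume e_X: "\<psi> e \<notin> fvs.span (\<psi> ` X)"
    have "flat (vmat \<psi> H) X" using X(1) unfolding eq .
    then have "flat (vmat \<psi> (insert e H)) X"
      using e_X H unfolding flat_vmat[OF H] flat_vmat[OF finite.insertI[OF H]] by blast
    then have "vmat \<psi> X \<in> \<M>" by (rule hereditary_vmat[OF her in_M])
    then show False using X(2) vmat_eq_subset[OF eq XH] by simp
  qed
  from extension_vmat[OF q \<psi> e eq XH this] obtain p where
    p: "p \<in> fvs.span (\<phi> ` X)" "p \<noteq> 0" "vmat (\<phi>(e := p)) (insert e H) = vmat \<psi> (insert e H)"
    by blast
  show ?thesis by (rule that[OF p(1,2)]) (use in_M p(3) in simp)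
qed

section \<open>Vectors representing the same projective point\<close>

lemma in_span_singleton_sym:
  assumes "p \<in> fvs.span {v}" "p \<noteq> 0"
  shows "v \<in> fvs.span {p}"
  using fvs.in_span_insert[of p v "{}"] assms by simp

lemma span_singleton_eq:
  assumes "p \<in> fvs.span {v}" "p \<noteq> 0"
  shows "fvs.span {p} = fvs.span {v}"
  unfolding fvs.span_eq using assms in_span_singleton_sym[OF assms] by simp

text \<open>Used to pass from an arbitrary added vector to the representative fixed in advance for
  its point.\<close>

lemma vmat_scale_point:
  assumes "fvs.span {p} = fvs.span {p'}" "p \<noteq> 0"
  shows "vmat (\<phi>(e := p)) E = vmat (\<phi>(e := p')) E"
proof -
  have "p \<in> fvs.span {p'}" using assms(1) fvs.span_base[of p "{p}"] by simp
  then obtain k where k: "p = fscale k p'" unfolding fvs.span_singleton by blast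
  then have "k \<noteq> 0" using assms(2) by auto
  show ?thesis
  proof (rule vmat_linear_image[OF fvs.linear_ident])
    fix x
    show "\<exists>c. c \<noteq> 0 \<and> (\<phi>(e := p)) x = fscale c ((\<phi>(e := p')) x)"
    proof (cases "x = e")
      case True
      then show ?thesis using k \<open>k \<noteq> 0\<close> by (intro exI[of _ k]) simp
    next
      case False
      then show ?thesis by (intro exI[of _ 1]) simp
    qed
  qed simp
qed

lemma vrep_extend:
  assumes \<phi>: "vrep \<phi> E" and X: "X \<subseteq> E" and p: "p \<in> fvs.span (\<phi> ` X)" "p \<noteq> 0"
    and new: "\<And>x. x \<in> E \<Longrightarrow> p \<notin> fvs.span {\<phi> x}" and e: "e \<notin> E"
  shows "vrep (\<phi>(e := p)) (insert e E)"
proof -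
  obtain n where n: "\<phi> ` E \<subseteq> coord_space n" using \<phi> unfolding vrep_def by blast
  have "fvs.span (\<phi> ` X) \<subseteq> coord_space n"
    by (rule fvs.span_minimal[OF _ subspace_coord_space]) (use n X in blast)
  then have "(\<phi>(e := p)) ` insert e E \<subseteq> coord_space n" using n p(1) e by auto
  moreover have "\<phi> x \<notin> fvs.span {p}" if x: "x \<in> E" for x
  proof
    assume "\<phi> x \<in> fvs.span {p}"
    moreover have "\<phi> x \<noteq> 0" using \<phi> x unfolding vrep_def by blast
    ultimately show False using in_span_singleton_sym new x by blast
  qed
  moreover have "finite E" "\<forall>x\<in>E. \<phi> x \<noteq> 0" "\<forall>x\<in>E. \<forall>y\<in>E. x \<noteq> y \<longrightarrow> \<phi> x \<notin> fvs.span {\<phi> y}"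
    using \<phi> unfolding vrep_def by simp_all
  ultimately show ?thesis
    using e p(2) new unfolding vrep_def
    by (intro conjI ballI impI exI[of _ n]) (simp_all, blast+)
qed

section \<open>Forbidden flats of the add class\<close>

text \<open>Steinitz exchange: some basis vector occurs in \<open>w\<close> and can be replaced by
  it. If \<open>w\<close> already lies in another span, only \<open>fvs.dim V - 1\<close> new
  vectors are needed, which is the source of the factor \<open>s - 1\<close>. The subtraction is
  exact since \<open>w\<close> is nonzero.\<close>

lemma basis_through_vector:
  assumes V: "finite V" and w: "w \<in> fvs.span V" "w \<noteq> 0"
  obtains C where "finite C" "card C = fvs.dim V - 1" "V \<subseteq> fvs.span (insert w C)"
proof -
  obtain B where B: "finite B" "card B = fvs.dim V" "fvs.span B = fvs.span V" and ind: "fvs.independent B"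
    by (rule basis_card_dim[OF V])
  have wB: "w \<in> fvs.span B" using w(1) unfolding B(3) .
  have "\<exists>b\<in>B. w \<notin> fvs.span (B - {b})"
  proof (rule ccontr)
    assume "\<not> (\<exists>b\<in>B. w \<notin> fvs.span (B - {b}))"
    then have "w \<in> fvs.span (B - B)"
      using span_Diff_if_spans_delete[OF ind wB, of B] by blast
    then show False using w(2) by simp
  qed
  then obtain b where b: "b \<in> B" "w \<notin> fvs.span (B - {b})" by blast
  from fvs.in_span_delete[OF wB b(2)] have "b \<in> fvs.span (insert w (B - {b}))" .
  then have "B \<subseteq> fvs.span (insert w (B - {b}))"
    using fvs.span_base[of _ "insert w (B - {b})"] by blast
  from fvs.span_minimal[OF this] have "fvs.span B \<subseteq> fvs.span (insert w (B - {b}))" by simp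
  then have "V \<subseteq> fvs.span (insert w (B - {b}))"
    unfolding B(3) by (rule order_trans[OF fvs.span_superset])
  then show ?thesis by (rule that[rotated 2]) (use B(1,2) b(1) in simp_all)
qed

text \<open>The chosen point is new: it is no element of \<open>X\<close> by the choice of
  \<open>P\<close>, and no other element of \<open>E\<close> since \<open>X\<close> is a flat. The
  extension is therefore simple, and were it in \<open>\<M>\<close>, it would put
  \<open>vmat \<phi> E\<close> into the add class. \<open>Y\<close> may or may not contain
  \<open>e\<close>.\<close>

lemma forbidden_flat_through_point:
  fixes \<M> :: "'e matroid set" and \<phi> :: "'e \<Rightarrow> nat \<Rightarrow> 'f::{field,finite}"
  assumes \<phi>: "vrep \<phi> E" and e: "e \<notin> E" and notin: "vmat \<phi> E \<notin> add_class TYPE('f) \<M>"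
    and X: "flat (vmat \<phi> E) X"
    and P: "P \<in> points_of (fvs.span (\<phi> ` X)) - (\<lambda>x. fvs.span {\<phi> x}) ` X"
  obtains p Y where "P = fvs.span {p}" "p \<in> fvs.span (\<phi> ` X)" "p \<noteq> 0"
    "flat (vmat (\<phi>(e := p)) (insert e E)) Y"
    "vmat (\<phi>(e := p)) Y \<in> forbidden_flats TYPE('f) \<M>"
proof -
  obtain p where p: "p \<in> fvs.span (\<phi> ` X)" "p \<noteq> 0" "P = fvs.span {p}"
    using P unfolding points_of_def by blast
  have E: "finite E" using \<phi> by (simp add: vrep_def)
  have XE: "X \<subseteq> E" and X': "\<And>x. x \<in> E - X \<Longrightarrow> \<phi> x \<notin> fvs.span (\<phi> ` X)"
    using X unfolding flat_vmat[OF E] by blast+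
  have new: "p \<notin> fvs.span {\<phi> x}" if x: "x \<in> E" for x
  proof
    assume p_x: "p \<in> fvs.span {\<phi> x}"
    show False
    proof (cases "x \<in> X")
      case True
      then show False using P p(3) span_singleton_eq[OF p_x p(2)] by blast
    next
      case False
      have "fvs.span {p} \<subseteq> fvs.span (\<phi> ` X)"
        by (rule fvs.span_minimal) (use p(1) in simp_all)
      then show False using in_span_singleton_sym[OF p_x p(2)] X' x False by blast
    qed
  qed
  have ext: "vrep (\<phi>(e := p)) (insert e E)"
    by (rule vrep_extend[OF \<phi> XE p(1,2) new e])
  have "vmat (\<phi>(e := p)) (insert e E) \<notin> \<M>"
  proof
    assume in_M: "vmat (\<phi>(e := p)) (insert e E) \<in> \<M>"
    have "delete (vmat (\<phi>(e := p)) (insert e E)) e = vmat \<phi> E"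
      unfolding delete_vmat[OF e] vmat_fun_upd[OF e] ..
    moreover have "matroid_iso (vmat \<phi> E) (vmat \<phi> E)"
      unfolding matroid_iso_def by (rule exI[of _ id]) simp
    ultimately have "vmat \<phi> E \<in> add_class TYPE('f) \<M>"
      unfolding add_class_def mem_Collect_eq
      by (intro conjI disjI2 exI[of _ "vmat (\<phi>(e := p)) (insert e E)"] exI[of _ e]
          gf_matroid_vmat[OF \<phi>] gf_matroid_vmat[OF ext] in_M) simp_all
    then show False using notin by blast
  qed
  from exists_forbidden_flat[OF ext this] obtain Y where
    "flat (vmat (\<phi>(e := p)) (insert e E)) Y" "vmat (\<phi>(e := p)) Y \<in> forbidden_flats TYPE('f) \<M>"
    by blast
  then show ?thesis using that[of p Y] p by blast
qed

text \<open>Otherwise the elements in the span of \<open>W\<close> form a proper flat, which lies in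
  the add class. By \<open>add_class_extension\<close> its extension by some point in the span of
  \<open>X\<close> is in \<open>\<M>\<close>, which \<open>ext\<close> excludes. Both cases of the
  rank bound reduce to supplying \<open>ext\<close>.\<close>

lemma closure_spanning_flats_eq:
  fixes \<M> :: "'e matroid set" and \<phi> :: "'e \<Rightarrow> nat \<Rightarrow> 'f::{field,finite}"
  assumes q: "CARD('f) \<in> {2, 3}" and cls: "gf_class TYPE('f) \<M>" and her: "hereditary \<M>"
    and E: "finite E" and e: "e \<notin> E"
    and proper: "\<And>H. flat (vmat \<phi> E) H \<Longrightarrow> H \<noteq> E \<Longrightarrow> vmat \<phi> H \<in> add_class TYPE('f) \<M>"
    and X: "flat (vmat \<phi> E) X" "vmat \<phi> X \<notin> \<M>" "\<phi> ` X \<subseteq> fvs.span W"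
    and ext: "\<And>H p. X \<subseteq> H \<Longrightarrow> H \<subseteq> E \<Longrightarrow> (\<And>x. x \<in> E \<Longrightarrow> \<phi> x \<in> fvs.span W \<Longrightarrow> x \<in> H) \<Longrightarrow>
      p \<in> fvs.span (\<phi> ` X) \<Longrightarrow> p \<noteq> 0 \<Longrightarrow> vmat (\<phi>(e := p)) (insert e H) \<notin> \<M>"
  shows "\<phi> ` E \<subseteq> fvs.span W"
proof (rule ccontr)
  assume nsub: "\<not> \<phi> ` E \<subseteq> fvs.span W"
  define H where "H = {x \<in> E. \<phi> x \<in> fvs.span W}"
  have H: "flat (vmat \<phi> E) H" unfolding H_def by (rule flat_vmat_closure[OF E])
  have "H \<noteq> E" using nsub unfolding H_def by blast
  have HE: "H \<subseteq> E" unfolding H_def by blast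
  have fH: "finite H" by (rule finite_subset[OF HE E])
  have "X \<subseteq> E" using X(1) unfolding flat_vmat[OF E] by blast
  then have XH: "X \<subseteq> H" using X(3) unfolding H_def by blast
  have "e \<notin> H" using HE e by blast
  from add_class_extension[OF q cls her fH this proper[OF H \<open>H \<noteq> E\<close>] flat_vmat_subset[OF E X(1) XH HE] X(2)]
  obtain p where "p \<in> fvs.span (\<phi> ` X)" "p \<noteq> 0" "vmat (\<phi>(e := p)) (insert e H) \<in> \<M>"
    by blast
  then show False using ext[OF XH HE] unfolding H_def by blast
qed

lemma flat_extension:
  assumes E: "finite E" and HE: "H \<subseteq> E" and Y: "flat (vmat \<phi> (insert e E)) Y" "Y \<subseteq> insert e H"
  shows "flat (vmat \<phi> (insert e H)) Y"
  by (rule flat_vmat_subset[OF _ Y]) (use E HE in auto)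

text \<open>A new point lies in the span of at most one of \<open>X\<close> and \<open>Y\<close>, so the other one survives as a flat.\<close>

lemma rank_bound_disjoint:
  fixes \<M> :: "'e matroid set" and \<phi> :: "'e \<Rightarrow> nat \<Rightarrow> 'f::{field,finite}"
  assumes q: "CARD('f) \<in> {2, 3}" and cls: "gf_class TYPE('f) \<M>" and her: "hereditary \<M>"
    and E: "finite E" and e: "e \<notin> E"
    and proper: "\<And>H. flat (vmat \<phi> E) H \<Longrightarrow> H \<noteq> E \<Longrightarrow> vmat \<phi> H \<in> add_class TYPE('f) \<M>"
    and X: "flat (vmat \<phi> E) X" "vmat \<phi> X \<notin> \<M>"
    and Y: "flat (vmat \<phi> E) Y" "vmat \<phi> Y \<notin> \<M>"
    and disj: "fvs.span (\<phi> ` X) \<inter> fvs.span (\<phi> ` Y) \<subseteq> {0}"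
  shows "fvs.dim (\<phi> ` E) \<le> fvs.dim (\<phi> ` X) + fvs.dim (\<phi> ` Y)"
proof -
  have XE: "X \<subseteq> E" and YE: "Y \<subseteq> E" and Y': "\<And>x. x \<in> E - Y \<Longrightarrow> \<phi> x \<notin> fvs.span (\<phi> ` Y)"
    using X(1) Y(1) unfolding flat_vmat[OF E] by blast+
  obtain A where A: "finite A" "card A = fvs.dim (\<phi> ` X)" "fvs.span A = fvs.span (\<phi> ` X)"
    by (rule basis_card_dim[OF finite_imageI[OF finite_subset[OF XE E]]])
  obtain B where B: "finite B" "card B = fvs.dim (\<phi> ` Y)" "fvs.span B = fvs.span (\<phi> ` Y)"
    by (rule basis_card_dim[OF finite_imageI[OF finite_subset[OF YE E]]])
  have XW: "\<phi> ` X \<subseteq> fvs.span (A \<union> B)"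
    using fvs.span_superset[of "\<phi> ` X"] fvs.span_mono[of A "A \<union> B"] A(3) by blast
  have YW: "\<phi> ` Y \<subseteq> fvs.span (A \<union> B)"
    using fvs.span_superset[of "\<phi> ` Y"] fvs.span_mono[of B "A \<union> B"] B(3) by blast
  have "\<phi> ` E \<subseteq> fvs.span (A \<union> B)"
  proof (rule closure_spanning_flats_eq[OF q cls her E e proper X XW])
    fix H p assume HE: "H \<subseteq> E" and H: "\<And>x. x \<in> E \<Longrightarrow> \<phi> x \<in> fvs.span (A \<union> B) \<Longrightarrow> x \<in> H"
      and p: "p \<in> fvs.span (\<phi> ` X)" "p \<noteq> 0"
    have YH: "Y \<subseteq> H" using H YE YW by blast
    have fH: "finite (insert e H)" using HE E finite_subset by blast
    have eY: "e \<notin> Y" using YE e by blast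
    show "vmat (\<phi>(e := p)) (insert e H) \<notin> \<M>"
    proof
      assume in_M: "vmat (\<phi>(e := p)) (insert e H) \<in> \<M>"
      have img: "(\<phi>(e := p)) ` Y = \<phi> ` Y" using eY by auto
      have "p \<notin> fvs.span (\<phi> ` Y)" using disj p by blast
      then have "(\<phi>(e := p)) x \<notin> fvs.span (\<phi> ` Y)" if "x \<in> insert e H - Y" for x
        using that Y'[of x] HE by (cases "x = e") auto
      then have "flat (vmat (\<phi>(e := p)) (insert e H)) Y"
        unfolding flat_vmat[OF fH] img using YH by blast
      from hereditary_vmat[OF her in_M this] have "vmat \<phi> Y \<in> \<M>"
        unfolding vmat_fun_upd[OF eY] .
      then show False using Y(2) by blast
    qed
  qed
  then have "fvs.dim (\<phi> ` E) \<le> card (A \<union> B)"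
    by (rule fvs.dim_le_card) (use A(1) B(1) in simp)
  also have "\<dots> \<le> card A + card B" by (rule card_Un_le)
  finally show ?thesis unfolding A(2) B(2) .
qed

text \<open>Here \<open>s\<close> is any upper bound for the ranks, and a disjunction stands in for
  the maximum. Its alternatives correspond to whether one of the forbidden flats chosen below meets
  the span of \<open>X\<close> trivially.\<close>

lemma forbidden_flat_rank_bound:
  fixes \<M> :: "'e matroid set" and \<phi> :: "'e \<Rightarrow> nat \<Rightarrow> 'f::{field,finite}"
  assumes q: "CARD('f) \<in> {2, 3}" and cls: "gf_class TYPE('f) \<M>" and her: "hereditary \<M>"
    and \<phi>: "vrep \<phi> E" and e: "e \<notin> E" and notin: "vmat \<phi> E \<notin> add_class TYPE('f) \<M>"
    and proper: "\<And>H. flat (vmat \<phi> E) H \<Longrightarrow> H \<noteq> E \<Longrightarrow> vmat \<phi> H \<in> add_class TYPE('f) \<M>"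
    and s: "\<And>F. F \<in> forbidden_flats TYPE('f) \<M> \<Longrightarrow> mrank F \<le> s"
  shows "mrank (vmat \<phi> E) \<le> 2 * s \<or>
    (\<exists>F\<in>forbidden_flats TYPE('f) \<M>. mrank (vmat \<phi> E) \<le> mrank F + num_nonelements TYPE('f) F * (s - 1))"
proof -
  have E: "finite E" using \<phi> by (simp add: vrep_def)
  have not_in: "F \<notin> \<M>" if "F \<in> forbidden_flats TYPE('f) \<M>" for F
    using that unfolding forbidden_flats_def by blast
  have "vmat \<phi> E \<notin> \<M>"
    using notin gf_matroid_vmat[OF \<phi>] unfolding add_class_def by blast
  from exists_forbidden_flat[OF \<phi> this] obtain X where X: "flat (vmat \<phi> E) X"
    and FX: "vmat \<phi> X \<in> forbidden_flats TYPE('f) \<M>" by blast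
  have XE: "X \<subseteq> E" using X unfolding flat_vmat[OF E] by blast
  have fX: "finite X" by (rule finite_subset[OF XE E])
  \<comment> \<open>The non-elements of \<open>X\<close>. Each gets a fixed vector
    \<open>p P\<close> and a forbidden flat \<open>Y P\<close> of the extension by it.\<close>
  define R where "R = points_of (fvs.span (\<phi> ` X)) - (\<lambda>x. fvs.span {\<phi> x}) ` X"
  have "\<exists>p Y. P = fvs.span {p} \<and> p \<in> fvs.span (\<phi> ` X) \<and> p \<noteq> 0 \<and>
      flat (vmat (\<phi>(e := p)) (insert e E)) Y \<and> vmat (\<phi>(e := p)) Y \<in> forbidden_flats TYPE('f) \<M>"
    if "P \<in> R" for P
    using forbidden_flat_through_point[OF \<phi> e notin X that[unfolded R_def]] by metis
  then obtain p Y where pY: "\<And>P. P \<in> R \<Longrightarrow> P = fvs.span {p P}"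
    "\<And>P. P \<in> R \<Longrightarrow> p P \<in> fvs.span (\<phi> ` X)" "\<And>P. P \<in> R \<Longrightarrow> p P \<noteq> 0"
    "\<And>P. P \<in> R \<Longrightarrow> flat (vmat (\<phi>(e := p P)) (insert e E)) (Y P)"
    "\<And>P. P \<in> R \<Longrightarrow> vmat (\<phi>(e := p P)) (Y P) \<in> forbidden_flats TYPE('f) \<M>"
    by metis
  define V where "V P = (\<phi>(e := p P)) ` Y P" for P
  have YE: "Y P \<subseteq> insert e E" if "P \<in> R" for P
    using pY(4)[OF that] unfolding flat_def by simp
  have fY: "finite (Y P)" if "P \<in> R" for P
    using YE[OF that] E finite_subset by blast
  have fV: "finite (V P)" if "P \<in> R" for P
    unfolding V_def by (rule finite_imageI[OF fY[OF that]])
  have dimV: "fvs.dim (V P) \<le> s" if "P \<in> R" for P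
    using s[OF pY(5)[OF that]] unfolding V_def mrank_vmat[OF fY[OF that]] .
  have dimX: "fvs.dim (\<phi> ` X) \<le> s"
    using s[OF FX] unfolding mrank_vmat[OF fX] .
  show ?thesis
  proof (cases "\<exists>P\<in>R. fvs.span (\<phi> ` X) \<inter> fvs.span (V P) \<subseteq> {0}")
    case True
    then obtain P where P: "P \<in> R" and disj: "fvs.span (\<phi> ` X) \<inter> fvs.span (V P) \<subseteq> {0}" by blast
    \<comment> \<open>The added point lies in the span of \<open>X\<close>, so \<open>Y P\<close>
      cannot contain it and is a flat of \<open>vmat \<phi> E\<close> itself.\<close>
    have eY: "e \<notin> Y P"
    proof
      assume "e \<in> Y P"
      then have "p P \<in> V P" unfolding V_def by (intro image_eqI[of _ _ e]) simp_all
      then have "p P \<in> fvs.span (V P)" by (rule fvs.span_base)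
      then show False using pY(2,3)[OF P] disj by blast
    qed
    have V_eq: "V P = \<phi> ` Y P"
      unfolding V_def by (rule image_cong) (use eY in auto)
    have YPE: "Y P \<subseteq> E" using YE[OF P] eY by blast
    have "flat (vmat (\<phi>(e := p P)) E) (Y P)"
      by (rule flat_vmat_subset[OF _ pY(4)[OF P] YPE]) (use E in auto)
    then have Yflat: "flat (vmat \<phi> E) (Y P)" unfolding vmat_fun_upd[OF e] .
    have "vmat \<phi> (Y P) \<notin> \<M>"
      using not_in[OF pY(5)[OF P]] unfolding vmat_fun_upd[OF eY] .
    from rank_bound_disjoint[OF q cls her E e proper X not_in[OF FX] Yflat this disj[unfolded V_eq]]
    have "mrank (vmat \<phi> E) \<le> 2 * s"
      using dimX dimV[OF P] unfolding mrank_vmat[OF E] V_eq by linarith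
    then show ?thesis ..
  next
    case False
    \<comment> \<open>Each \<open>V P\<close> shares a nonzero vector with the span of
      \<open>X\<close>, and a basis through it leaves at most \<open>s - 1\<close> further
      vectors.\<close>
    have "\<exists>w C. w \<in> fvs.span (\<phi> ` X) \<and> finite C \<and> card C \<le> s - 1 \<and> V P \<subseteq> fvs.span (insert w C)"
      if P: "P \<in> R" for P
    proof -
      obtain w where w: "w \<in> fvs.span (\<phi> ` X)" "w \<in> fvs.span (V P)" "w \<noteq> 0"
        using False P by blast
      obtain C where "finite C" "card C = fvs.dim (V P) - 1" "V P \<subseteq> fvs.span (insert w C)"
        by (rule basis_through_vector[OF fV[OF P] w(2,3)])
      then show ?thesis using w(1) dimV[OF P] diff_le_mono by metis
    qed
    then obtain w C where C: "\<And>P. P \<in> R \<Longrightarrow> w P \<in> fvs.span (\<phi> ` X)"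
      "\<And>P. P \<in> R \<Longrightarrow> finite (C P)" "\<And>P. P \<in> R \<Longrightarrow> card (C P) \<le> s - 1"
      "\<And>P. P \<in> R \<Longrightarrow> V P \<subseteq> fvs.span (insert (w P) (C P))"
      by metis
    obtain A where A: "finite A" "card A = fvs.dim (\<phi> ` X)" "fvs.span A = fvs.span (\<phi> ` X)"
      by (rule basis_card_dim[OF finite_imageI[OF fX]])
    \<comment> \<open>A basis of the span of \<open>X\<close> with the further vectors of each
      \<open>V P\<close>. It spans \<open>X\<close> and every \<open>V P\<close>, and counting it
      gives the bound.\<close>
    define W where "W = A \<union> (\<Union>P\<in>R. C P)"
    have R: "finite R" "card R \<le> num_nonelements TYPE('f) (vmat \<phi> X)"
      using card_nonelements_le[OF vrep_subset[OF \<phi> XE]] unfolding R_def by blast+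
    have spX: "fvs.span (\<phi> ` X) \<subseteq> fvs.span W"
      unfolding A(3)[symmetric] W_def by (rule fvs.span_mono) blast
    then have XW: "\<phi> ` X \<subseteq> fvs.span W" by (rule order_trans[OF fvs.span_superset])
    have VW: "V P \<subseteq> fvs.span W" if P: "P \<in> R" for P
    proof -
      have "C P \<subseteq> fvs.span W"
        using fvs.span_superset[of W] P unfolding W_def by blast
      then have "insert (w P) (C P) \<subseteq> fvs.span W" using C(1)[OF P] spX by blast
      then have "fvs.span (insert (w P) (C P)) \<subseteq> fvs.span W"
        by (rule fvs.span_minimal) (rule fvs.subspace_span)
      then show ?thesis using C(4)[OF P] by blast
    qed
    have "\<phi> ` E \<subseteq> fvs.span W"
    proof (rule closure_spanning_flats_eq[OF q cls her E e proper X not_in[OF FX] XW])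
      fix H v assume XH: "X \<subseteq> H" and HE: "H \<subseteq> E"
        and H: "\<And>x. x \<in> E \<Longrightarrow> \<phi> x \<in> fvs.span W \<Longrightarrow> x \<in> H"
        and v: "v \<in> fvs.span (\<phi> ` X)" "v \<noteq> 0"
      show "vmat (\<phi>(e := v)) (insert e H) \<notin> \<M>"
      proof
        assume in_M: "vmat (\<phi>(e := v)) (insert e H) \<in> \<M>"
        \<comment> \<open>Simplicity of a member of \<open>\<M>\<close> prevents \<open>v\<close>
          from repeating an element of \<open>X\<close>, so its point is in \<open>R\<close> and has
          a flat \<open>Y P\<close>.\<close>
        then have "simple (vmat (\<phi>(e := v)) (insert e H))"
          using cls unfolding gf_class_def gf_matroid_def by blast
        then have new: "v \<notin> fvs.span {\<phi> x}" if "x \<in> X" for x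
          using that XH XE e unfolding simple_vmat
          by (metis fun_upd_apply insertCI subsetD)
        define P where "P = fvs.span {v}"
        have "P \<in> points_of (fvs.span (\<phi> ` X))" using v unfolding points_of_def P_def by blast
        moreover have "P \<noteq> fvs.span {\<phi> x}" if "x \<in> X" for x
          using new[OF that] fvs.span_base[of v "{v}"] unfolding P_def by auto
        ultimately have P: "P \<in> R" unfolding R_def by blast
        have in_M': "vmat (\<phi>(e := p P)) (insert e H) \<in> \<M>"
          using in_M vmat_scale_point[of v "p P" \<phi> e "insert e H"] v(2) pY(1)[OF P]
          unfolding P_def[symmetric] by simp
        \<comment> \<open>Apart from \<open>e\<close>, the elements of \<open>Y P\<close> lie in the
          span of \<open>W\<close> and hence in \<open>H\<close>. So \<open>Y P\<close> is a flat of
          the extension of \<open>H\<close>, and heredity puts a forbidden flat into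
          \<open>\<M>\<close>.\<close>
        have "Y P \<subseteq> insert e H"
        proof
          fix y assume y: "y \<in> Y P"
          show "y \<in> insert e H"
          proof (cases "y = e")
            case False
            then have "\<phi> y \<in> V P" using y unfolding V_def by (intro image_eqI[of _ _ y]) simp_all
            then show ?thesis using H[of y] VW[OF P] YE[OF P] y False by blast
          qed simp
        qed
        from flat_extension[OF E HE pY(4)[OF P] this]
        have "vmat (\<phi>(e := p P)) (Y P) \<in> \<M>" by (rule hereditary_vmat[OF her in_M'])
        then show False using not_in[OF pY(5)[OF P]] by blast
      qed
    qed
    then have "fvs.dim (\<phi> ` E) \<le> card W"
      by (rule fvs.dim_le_card) (use A(1) R(1) C(2) in \<open>simp add: W_def\<close>)
    also have "\<dots> \<le> card A + card (\<Union>P\<in>R. C P)" unfolding W_def by (rule card_Un_le)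
    also have "card (\<Union>P\<in>R. C P) \<le> (\<Sum>P\<in>R. card (C P))" by (rule card_UN_le[OF R(1)])
    also have "\<dots> \<le> card R * (s - 1)" using sum_bounded_above[of R "\<lambda>P. card (C P)" "s - 1"] C(3) by simp
    also have "\<dots> \<le> num_nonelements TYPE('f) (vmat \<phi> X) * (s - 1)" using R(2) by (rule mult_le_mono1)
    finally have "mrank (vmat \<phi> E) \<le> mrank (vmat \<phi> X) + num_nonelements TYPE('f) (vmat \<phi> X) * (s - 1)"
      unfolding mrank_vmat[OF E] mrank_vmat[OF fX] A(2) by simp
    then show ?thesis using FX by blast
  qed
qed

theorem theorem5p2:
  fixes \<M> \<F> :: "'e::infinite matroid set"
    and M :: "'e matroid"
    and s :: nat
  assumes "CARD('f::{field,finite}) \<in> {2, 3}"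
    and "gf_class TYPE('f) \<M>"
    and "hereditary \<M>"
    and "\<F> = forbidden_flats TYPE('f) \<M>"
    and "finite (mrank ` \<F>)"
    and "s = Max (mrank ` \<F>)"
    and "M \<in> forbidden_flats TYPE('f) (add_class TYPE('f) \<M>)"
  shows "mrank M \<le> Max ({2 * s} \<union> {mrank F + num_nonelements TYPE('f) F * (s - 1) | F. F \<in> \<F>})"
proof -
  have gf: "gf_matroid TYPE('f) M" and notin: "M \<notin> add_class TYPE('f) \<M>"
    and proper: "\<And>X. flat M X \<Longrightarrow> X \<noteq> ground M \<Longrightarrow> restrict_to M X \<in> add_class TYPE('f) \<M>"
    using assms(7) unfolding forbidden_flats_def by blast+
  obtain \<phi> :: "'e \<Rightarrow> nat \<Rightarrow> 'f" where \<phi>: "vrep \<phi> (ground M)" and M: "M = vmat \<phi> (ground M)"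
    by (rule gf_matroid_obtain[OF gf])
  define E where "E = ground M"
  have \<phi>': "vrep \<phi> E" and M': "M = vmat \<phi> E" using \<phi> M by (simp_all add: E_def)
  have "finite E" using \<phi>' by (simp add: vrep_def)
  \<comment> \<open>The infinite label type supplies a name for the point to be added.\<close>
  then obtain e where e: "e \<notin> E" using ex_new_if_finite[OF infinite_UNIV] by blast
  have s: "mrank F \<le> s" if "F \<in> forbidden_flats TYPE('f) \<M>" for F
    unfolding assms(6) by (rule Max_ge[OF assms(5)]) (use that assms(4) in simp)
  have proper': "vmat \<phi> H \<in> add_class TYPE('f) \<M>" if H: "flat (vmat \<phi> E) H" "H \<noteq> E" for H
  proof -
    have "H \<subseteq> E" using H(1) unfolding flat_def by simp
    then show ?thesis using proper[of H] H unfolding M' ground_vmat by (simp add: restrict_to_vmat)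
  qed
  have "mrank M \<le> 2 * s \<or>
    (\<exists>F\<in>\<F>. mrank M \<le> mrank F + num_nonelements TYPE('f) F * (s - 1))"
    using forbidden_flat_rank_bound[OF assms(1-3) \<phi>' e notin[unfolded M'] proper' s]
    unfolding M' assms(4) by blast
  \<comment> \<open>\<open>\<F>\<close> need not be finite, but only finitely many ranks occur, and
    the rank bounds the number of non-elements by the number of points of the geometry.\<close>
  moreover have "finite {mrank F + num_nonelements TYPE('f) F * (s - 1) | F. F \<in> \<F>}"
  proof (rule finite_subset)
    show "{mrank F + num_nonelements TYPE('f) F * (s - 1) | F. F \<in> \<F>} \<subseteq>
        (\<Union>r\<in>mrank ` \<F>. {..r + card (pg_points r :: (nat \<Rightarrow> 'f) set set) * (s - 1)})"
      by (auto simp: num_nonelements_def intro!: bexI mult_le_mono1)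
    show "finite (\<Union>r\<in>mrank ` \<F>. {..r + card (pg_points r :: (nat \<Rightarrow> 'f) set set) * (s - 1)})"
      using assms(5) by blast
  qed
  ultimately show ?thesis by (subst Max_ge_iff) auto
qed

end
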